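(* For $\mathcal T\in\mathbb T$ let $\mathcal T_*\succ\mathcal T$ be a uniform red-refinement and define $\Psi_{\mathcal T}=\{\psi_{\mathcal T,\nu}:\nu\in N^0_{\mathcal T}\}$ by $$\psi_{\mathcal T,\nu}:=2^{d+1}\mathbb 1_{\omega_{\mathcal T_*,\nu}}-\mathbb 1_{\omega_{\mathcal T,\nu}}\qquad(\nu\in N^0_{\mathcal T}).$$ Then, with constants independent of $\mathcal T\in\mathbb T$, $$|\langle\phi_{\mathcal T,\nu},\psi_{\mathcal T,\nu'}\rangle_{L_2(\Omega)}|\eqsim\delta_{\nu\nu'}\|\phi_{\mathcal T,\nu}\|_{L_2(\Omega)}\|\psi_{\mathcal T,\nu'}\|_{L_2(\Omega)}\quad(\nu,\nu'\in N^0_{\mathcal T}),$$ $\operatorname{supp}\psi_{\mathcal T,\nu}=\omega_{\mathcal T,\nu}$ for $\nu\in N^0_{\mathcal T}$, and $$\langle\psi_{\mathcal T,\nu},\phi_{\mathcal T,\nu'}\rangle_{L_2(\Omega)}=\delta_{\nu\nu'}|\omega_{\mathcal T,\nu}|\qquad(\nu,\nu'\in N^0_{\mathcal T}).$$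
   Context: $\Omega\subset\mathbb R^d$ is a bounded polytopal domain and $\gamma\subset\partial\Omega$ is measurable, closed and possibly empty. $\mathbb T$ is a family of conforming partitions $\mathcal T$ of $\Omega$ into closed uniformly shape regular $d$-simplices; neighbouring simplices (those with $T\cap T'\neq\emptyset$) have uniformly comparable sizes (a consequence of conformity and shape regularity for $d>1$, imposed for $d=1$). For every $\mathcal T$, $\gamma$ is the (possibly empty) union of $(d-1)$-faces of simplices $T\in\mathcal T$. $N^0_{\mathcal T}$ is the set of vertices of $\mathcal T$ not on $\gamma$. For a partition $\mathcal S$ ($=\mathcal T$ or $\mathcal T_*$) and a vertex $\nu$, $\omega_{\mathcal S,\nu}:=\bigcup\{T\in\mathcal S:\nu\in T\}$, and $|\omega|$ denotes volume. $\mathbb 1_K$ is the indicator function of $K$. $\{\phi_{\mathcal T,\nu}:\nu\in N^0_{\mathcal T}\}$ is the nodal basis, $\phi_{\mathcal T,\nu}(\nu')=\delta_{\nu\nu'}$, of the space $\{u\in H^1_{0,\gamma}(\Omega):u|_T\in\mathcal P_1\ (T\in\mathcal T)\}$, where $H^1_{0,\gamma}(\Omega)$ consists of the $H^1(\Omega)$-functions vanishing on $\gamma$. Uniform red-refinement: every $T\in\mathcal T$ is subdivided into $2^d$ subsimplices of equal volume; for each vertex $\nu$ of $T$ exactly one of them, the corner simplex $T_{*,\nu}$, contains $\nu$, and it is the image of $T$ under the homothety with centre $\nu$ and ratio $1/2$ (the remaining subsimplices are not uniquely determined for $d\ge3$, but are not relevant here). $\lambda\eqsim\mu$ means that $c\mu\le\lambda\le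 C\mu$ with constants $c,C>0$ independent of $\mathcal T\in\mathbb T$ and of the vertices. *)

theory Defs
  imports "HOL-Analysis.Analysis"
begin

section \<open>The Sobolev space with homogeneous Dirichlet data on a part of the boundary\<close>

text \<open>Elements of function spaces are pointwise defined functions on the whole space; only their
  values on the domain (up to null sets) matter for the notions of this section.\<close>

definition L2_on :: "'a::euclidean_space set \<Rightarrow> ('a \<Rightarrow> 'b::euclidean_space) \<Rightarrow> bool" where
  "L2_on \<Omega> f \<longleftrightarrow>
     set_borel_measurable lebesgue \<Omega> f \<and> set_integrable lebesgue \<Omega> (\<lambda>x. (norm (f x))\<^sup>2)"

definition L2_inner :: "'a::euclidean_space set \<Rightarrow> ('a \<Rightarrow> real) \<Rightarrow> ('a \<Rightarrow> real) \<Rightarrow> real" where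
  "L2_inner \<Omega> f g = (LINT x:\<Omega>|lebesgue. f x * g x)"

definition L2_norm :: "'a::euclidean_space set \<Rightarrow> ('a \<Rightarrow> real) \<Rightarrow> real" where
  "L2_norm \<Omega> f = sqrt (L2_inner \<Omega> f f)"

primrec C_k :: "nat \<Rightarrow> ('a::euclidean_space \<Rightarrow> real) \<Rightarrow> bool" where
  "C_k 0 f \<longleftrightarrow> continuous_on UNIV f"
| "C_k (Suc k) f \<longleftrightarrow> (\<exists>g. (\<forall>x. GDERIV f x :> g x) \<and> (\<forall>i\<in>Basis. C_k k (\<lambda>x. g x \<bullet> i)))"

definition smooth :: "('a::euclidean_space \<Rightarrow> real) \<Rightarrow> bool" where
  "smooth f \<longleftrightarrow> (\<forall>k. C_k k f)"

definition test_function :: "'a::euclidean_space set \<Rightarrow> ('a \<Rightarrow> real) \<Rightarrow> bool" where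
  "test_function \<Omega> \<eta> \<longleftrightarrow>
     smooth \<eta> \<and> compact (closure {x. \<eta> x \<noteq> 0}) \<and> closure {x. \<eta> x \<noteq> 0} \<subseteq> \<Omega>"

definition weak_gradient :: "'a::euclidean_space set \<Rightarrow> ('a \<Rightarrow> real) \<Rightarrow> ('a \<Rightarrow> 'a) \<Rightarrow> bool" where
  "weak_gradient \<Omega> u g \<longleftrightarrow>
     (\<forall>\<eta> g\<^sub>\<eta>. test_function \<Omega> \<eta> \<and> (\<forall>x. GDERIV \<eta> x :> g\<^sub>\<eta> x) \<longrightarrow>
        (\<forall>i\<in>Basis. (LINT x:\<Omega>|lebesgue. u x * (g\<^sub>\<eta> x \<bullet> i)) =
                    - (LINT x:\<Omega>|lebesgue. (g x \<bullet> i) * \<eta> x)))"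

definition H1 :: "'a::euclidean_space set \<Rightarrow> ('a \<Rightarrow> real) set" where
  "H1 \<Omega> = {u. L2_on \<Omega> u \<and> (\<exists>g. weak_gradient \<Omega> u g \<and> L2_on \<Omega> g)}"

text \<open>An \<open>H1\<close>-function vanishes on the null set \<open>\<gamma>\<close> in the usual (trace) sense: it is a limit, in
  the norm of \<open>H1 \<Omega>\<close>, of restrictions of smooth functions that vanish on \<open>\<gamma>\<close>.\<close>

definition H1_0 :: "'a::euclidean_space set \<Rightarrow> 'a set \<Rightarrow> ('a \<Rightarrow> real) set" where
  "H1_0 \<Omega> \<gamma> = {u \<in> H1 \<Omega>.
     \<exists>g w g\<^sub>w. weak_gradient \<Omega> u g \<and> L2_on \<Omega> g \<and>
       (\<forall>n::nat. smooth (w n) \<and> (\<forall>x. GDERIV (w n) x :> g\<^sub>w n x) \<and> (\<forall>x\<in>\<gamma>. w n x = 0)) \<and>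
       (\<lambda>n. LINT x:\<Omega>|lebesgue. (w n x - u x)\<^sup>2) \<longlonglongrightarrow> 0 \<and>
       (\<lambda>n. LINT x:\<Omega>|lebesgue. (norm (g\<^sub>w n x - g x))\<^sup>2) \<longlonglongrightarrow> 0}"


section \<open>Domains and partitions\<close>

definition polytopal_domain :: "'a::euclidean_space set \<Rightarrow> bool" where
  "polytopal_domain \<Omega> \<longleftrightarrow> open \<Omega> \<and> connected \<Omega> \<and> \<Omega> \<noteq> {} \<and>
     (\<exists>\<P>. finite \<P> \<and> (\<forall>P\<in>\<P>. polytope P \<and> aff_dim P = int DIM('a) - 1) \<and>
           frontier \<Omega> = \<Union>\<P>)"

definition conforming_partition :: "'a::euclidean_space set \<Rightarrow> 'a set set \<Rightarrow> bool" where
  "conforming_partition \<Omega> \<T> \<longleftrightarrow> triangulation \<T> \<and>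
     (\<forall>T\<in>\<T>. int DIM('a) simplex T \<and> interior T \<subseteq> \<Omega>) \<and> \<Union>\<T> = closure \<Omega>"

definition uniformly_shape_regular :: "'a::euclidean_space set set set \<Rightarrow> bool" where
  "uniformly_shape_regular \<TT> \<longleftrightarrow>
     (\<exists>\<kappa>>0. \<forall>\<T>\<in>\<TT>. \<forall>T\<in>\<T>. \<exists>x. cball x (\<kappa> * diameter T) \<subseteq> T)"

definition neighbours_comparable :: "'a::euclidean_space set set set \<Rightarrow> bool" where
  "neighbours_comparable \<TT> \<longleftrightarrow>
     (\<exists>C>0. \<forall>\<T>\<in>\<TT>. \<forall>T\<in>\<T>. \<forall>T'\<in>\<T>. T \<inter> T' \<noteq> {} \<longrightarrow> diameter T \<le> C * diameter T')"

definition union_of_facets :: "'a::euclidean_space set set \<Rightarrow> 'a set \<Rightarrow> bool" where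
  "union_of_facets \<T> \<gamma> \<longleftrightarrow> (\<exists>\<F>. (\<forall>F\<in>\<F>. \<exists>T\<in>\<T>. F facet_of T) \<and> \<gamma> = \<Union>\<F>)"

definition vertices :: "'a::euclidean_space set set \<Rightarrow> 'a set" where
  "vertices \<T> = {\<nu>. \<exists>T\<in>\<T>. \<nu> extreme_point_of T}"

definition free_vertices :: "'a::euclidean_space set \<Rightarrow> 'a set set \<Rightarrow> 'a set" where
  "free_vertices \<gamma> \<T> = vertices \<T> - \<gamma>"

definition patch :: "'a::euclidean_space set set \<Rightarrow> 'a \<Rightarrow> 'a set" where
  "patch \<S> \<nu> = \<Union>{T\<in>\<S>. \<nu> \<in> T}"


section \<open>Continuous piecewise affine finite elements\<close>

text \<open>Affinity is required pointwise on the closed simplices; this selects the representative of an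
  \<open>H1\<close>-class that is continuous on the closure of \<open>\<Omega>\<close>, so that nodal values make sense.\<close>

definition fe_space :: "'a::euclidean_space set \<Rightarrow> 'a set \<Rightarrow> 'a set set \<Rightarrow> ('a \<Rightarrow> real) set" where
  "fe_space \<Omega> \<gamma> \<T> = {u \<in> H1_0 \<Omega> \<gamma>. \<forall>T\<in>\<T>. \<exists>a b. \<forall>x\<in>T. u x = a \<bullet> x + b}"

definition nodal_basis ::
  "'a::euclidean_space set \<Rightarrow> 'a set \<Rightarrow> 'a set set \<Rightarrow> ('a \<Rightarrow> 'a \<Rightarrow> real) \<Rightarrow> bool" where
  "nodal_basis \<Omega> \<gamma> \<T> \<phi> \<longleftrightarrow>
     (\<forall>\<nu>\<in>free_vertices \<gamma> \<T>. \<phi> \<nu> \<in> fe_space \<Omega> \<gamma> \<T>) \<and>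
     (\<forall>u\<in>fe_space \<Omega> \<gamma> \<T>. \<exists>!c. c \<in> extensional (free_vertices \<gamma> \<T>) \<and>
        (\<forall>x\<in>\<Omega>. u x = (\<Sum>\<nu>\<in>free_vertices \<gamma> \<T>. c \<nu> * \<phi> \<nu> x))) \<and>
     (\<forall>\<nu>\<in>free_vertices \<gamma> \<T>. \<forall>\<nu>'\<in>free_vertices \<gamma> \<T>. \<phi> \<nu> \<nu>' = (if \<nu> = \<nu>' then 1 else 0))"


section \<open>Uniform red-refinement and the dual functions\<close>

definition corner_simplex :: "'a::euclidean_space set \<Rightarrow> 'a \<Rightarrow> 'a set" where
  "corner_simplex T \<nu> = (\<lambda>x. \<nu> + (1/2) *\<^sub>R (x - \<nu>)) ` T"

text \<open>Only the corner simplices are prescribed; in dimension at least three, the remaining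
  subsimplices are not uniquely determined.\<close>

definition red_subdivision :: "'a::euclidean_space set \<Rightarrow> 'a set set \<Rightarrow> bool" where
  "red_subdivision T \<R> \<longleftrightarrow>
     card \<R> = 2 ^ DIM('a) \<and> \<Union>\<R> = T \<and>
     pairwise (\<lambda>S S'. interior S \<inter> interior S' = {}) \<R> \<and>
     (\<forall>S\<in>\<R>. int DIM('a) simplex S \<and> measure lebesgue S = measure lebesgue T / 2 ^ DIM('a)) \<and>
     (\<forall>\<nu>. \<nu> extreme_point_of T \<longrightarrow> {S\<in>\<R>. \<nu> \<in> S} = {corner_simplex T \<nu>})"

definition uniform_red_refinement :: "'a::euclidean_space set set \<Rightarrow> 'a set set \<Rightarrow> bool" where
  "uniform_red_refinement \<T> \<S> \<longleftrightarrow>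
     (\<exists>R. (\<forall>T\<in>\<T>. red_subdivision T (R T)) \<and> \<S> = (\<Union>T\<in>\<T>. R T))"

definition dual_fun :: "'a::euclidean_space set set \<Rightarrow> 'a set set \<Rightarrow> 'a \<Rightarrow> 'a \<Rightarrow> real" where
  "dual_fun \<T> \<S> \<nu> x =
     2 ^ (DIM('a) + 1) * indicator (patch \<S> \<nu>) x - indicator (patch \<T> \<nu>) x"

definition supp_on :: "'a::euclidean_space set \<Rightarrow> ('a \<Rightarrow> real) \<Rightarrow> 'a set" where
  "supp_on \<Omega> f = closure {x\<in>\<Omega>. f x \<noteq> 0}"

end

theory Submission
  imports Defs
begin

text \<open>
  On a simplex \<open>T\<close> with vertex \<open>\<nu>\<close>, substituting the homothety with centre \<open>\<nu>\<close> and ratio \<open>1/2\<close>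
  shows that every affine \<open>p\<close> satisfies
  \<open>2 ^ (d + 1) * (integral of p over the corner simplex) - (integral of p over T) = p \<nu> * |T|\<close>.
  Summed over the mesh, this is the biorthogonality relation, provided the nodal functions have the
  expected values at all vertices, including those on \<open>\<gamma>\<close>.

  On \<open>\<gamma>\<close> this is a trace statement, since \<open>H1_0\<close> is defined by approximation.  If an affine \<open>u\<close> were
  nonzero at a point of a facet in \<open>\<gamma>\<close>, its \<open>L2\<close> norm squared on strips of height \<open>h\<close> over that facet
  would be at least a multiple of \<open>h\<close>, while a Poincare inequality for the smooth approximants, which
  vanish on the facet, bounds it by a multiple of \<open>h ^ 2\<close>.

  For the norms, \<open>0 \<le> \<phi> \<nu> \<le> 1\<close> and \<open>1 \<le> |\<psi> \<nu>| \<le> 2 ^ (d + 1)\<close> on the patch of \<open>\<nu>\<close>.  This bounds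
  both squared norms by the volume of the patch, up to constants depending only on \<open>d\<close>, and that of
  \<open>\<psi> \<nu>\<close> also from below; the lower bound for \<open>\<phi> \<nu>\<close> follows from Young's inequality and
  biorthogonality.
\<close>

section \<open>Traces of piecewise affine functions\<close>

text \<open>The fundamental theorem of calculus on the segment from \<open>y\<close> back to its
  foot, where \<open>w\<close> vanishes, bounds \<open>\<bar>w y\<bar>\<close> by the integral of
  \<open>\<bar>w'\<bar>\<close> along that segment. After integration over \<open>D\<close> and an
  exchange of integrals, each \<open>t\<close> between 0 and \<open>h\<close> contributes the same
  translation-invariant integral, hence the factor \<open>h\<close>.\<close>

lemma directional_derivative_strip_bound:
  fixes w w' :: "'a::euclidean_space \<Rightarrow> real" and \<sigma> :: "'a \<Rightarrow> real" and e :: 'a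
  assumes deriv: "\<And>x. ((\<lambda>t. w (x + t *\<^sub>R e)) has_real_derivative w' x) (at 0)"
    and cont: "continuous_on UNIV w'" and contw: "continuous_on UNIV w"
    and D: "D \<in> sets borel" "bounded D"
    and \<sigma>: "\<And>y. y \<in> D \<Longrightarrow> 0 < \<sigma> y \<and> \<sigma> y \<le> h"
    and zero: "\<And>y. y \<in> D \<Longrightarrow> w (y - \<sigma> y *\<^sub>R e) = 0"
    and inD: "\<And>y t. y \<in> D \<Longrightarrow> 0 \<le> t \<Longrightarrow> t < \<sigma> y \<Longrightarrow> y - t *\<^sub>R e \<in> D"
    and h: "0 \<le> h"
  shows "(LINT x:D|lborel. \<bar>w x\<bar>) \<le> h * (LINT x:D|lborel. \<bar>w' x\<bar>)"
proof -
  \<comment> \<open>Extension by zero outside \<open>D\<close> makes the integral of a translate of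
    \<open>G\<close> independent of the translation, so no moving domain has to be tracked.\<close>
  define G where "G x = ennreal (indicator D x * \<bar>w' x\<bar>)" for x
  have [measurable]: "D \<in> sets borel" by (rule D)
  have [measurable]: "w' \<in> borel_measurable borel" "w \<in> borel_measurable borel"
    using cont contw by (auto intro: borel_measurable_continuous_onI)
  have Gm [measurable]: "G \<in> borel_measurable borel" unfolding G_def by measurable
  have ftc: "ennreal \<bar>w y\<bar> \<le> (\<integral>\<^sup>+t. indicator {0..h} t * G (y - t *\<^sub>R e) \<partial>lborel)" if y: "y \<in> D" for y
  proof -
    have d: "((\<lambda>t. - w (y - t *\<^sub>R e)) has_real_derivative w' (y - t *\<^sub>R e)) (at t)" for t
    proof -
      have "((\<lambda>s. w ((y - t *\<^sub>R e) + s *\<^sub>R e)) has_real_derivative w' (y - t *\<^sub>R e)) (at (t - t))"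
        using deriv by simp
      then have "((\<lambda>s. w ((y - t *\<^sub>R e) + (t - s) *\<^sub>R e)) has_real_derivative w' (y - t *\<^sub>R e) * (0 - 1)) (at t)"
        by (rule DERIV_chain2) (auto intro!: derivative_eq_intros)
      then have "((\<lambda>s. w (y - s *\<^sub>R e)) has_real_derivative - w' (y - t *\<^sub>R e)) (at t)"
        by (simp add: algebra_simps)
      from DERIV_minus[OF this] show ?thesis by simp
    qed
    have cc: "continuous_on {0..\<sigma> y} (\<lambda>t. w' (y - t *\<^sub>R e))"
      by (rule continuous_on_compose2[OF cont]) (auto intro!: continuous_intros)
    have "has_bochner_integral lborel (\<lambda>t. indicator {0..\<sigma> y} t *\<^sub>R w' (y - t *\<^sub>R e)) (- w (y - \<sigma> y *\<^sub>R e) - - w (y - 0 *\<^sub>R e))"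
      using d \<sigma>[OF y] cc
      by (intro has_bochner_integral_FTC_Icc) (auto simp: has_real_derivative_iff_has_vector_derivative intro: has_vector_derivative_at_within)
    then have hb: "has_bochner_integral lborel (\<lambda>t. indicator {0..\<sigma> y} t *\<^sub>R w' (y - t *\<^sub>R e)) (w y)"
      using zero[OF y] by simp
    have "ennreal (norm (w y)) \<le> (\<integral>\<^sup>+t. ennreal (norm (indicator {0..\<sigma> y} t *\<^sub>R w' (y - t *\<^sub>R e))) \<partial>lborel)"
      using integral_norm_bound_ennreal[of lborel "\<lambda>t. indicator {0..\<sigma> y} t *\<^sub>R w' (y - t *\<^sub>R e)"] hb
      by (auto simp: has_bochner_integral_iff)
    also have "\<dots> \<le> (\<integral>\<^sup>+t. indicator {0..h} t * G (y - t *\<^sub>R e) \<partial>lborel)"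
    proof (rule nn_integral_mono_AE)
      \<comment> \<open>Only almost every \<open>t\<close> can be treated: at
        \<open>t = \<sigma> y\<close> the foot of the segment need not belong to
        \<open>D\<close>.\<close>
      show "AE t in lborel. ennreal (norm (indicator {0..\<sigma> y} t *\<^sub>R w' (y - t *\<^sub>R e))) \<le> indicator {0..h} t * G (y - t *\<^sub>R e)"
        using AE_lborel_singleton[of "\<sigma> y"]
      proof eventually_elim
        case (elim t)
        then show ?case using inD[OF y, of t] \<sigma>[OF y] by (auto simp: G_def indicator_def)
      qed
    qed
    finally show ?thesis by simp
  qed
  have "(\<integral>\<^sup>+y. ennreal (indicator D y * \<bar>w y\<bar>) \<partial>lborel) \<le>
      (\<integral>\<^sup>+y. (\<integral>\<^sup>+t. indicator {0..h} t * G (y - t *\<^sub>R e) \<partial>lborel) \<partial>lborel)"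
    using ftc by (intro nn_integral_mono) (auto simp: indicator_def)
  also have "\<dots> = (\<integral>\<^sup>+t. (\<integral>\<^sup>+y. indicator {0..h} t * G (y - t *\<^sub>R e) \<partial>lborel) \<partial>lborel)"
    by (rule lborel_pair.Fubini') measurable
  also have "\<dots> = (\<integral>\<^sup>+t. indicator {0..h} t * (\<integral>\<^sup>+y. G y \<partial>lborel) \<partial>lborel)"
  proof (rule nn_integral_cong)
    fix t :: real
    have "(\<integral>\<^sup>+y. G y \<partial>lborel) = (\<integral>\<^sup>+y. G y \<partial>distr lborel borel ((+) (- t *\<^sub>R e)))"
      by (simp add: lborel_distr_plus)
    also have "\<dots> = (\<integral>\<^sup>+y. G (- t *\<^sub>R e + y) \<partial>lborel)"
      by (rule nn_integral_distr) auto
    finally show "(\<integral>\<^sup>+y. indicator {0..h} t * G (y - t *\<^sub>R e) \<partial>lborel) = indicator {0..h} t * (\<integral>\<^sup>+y. G y \<partial>lborel)"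
      by (subst nn_integral_cmult) auto
  qed
  also have "\<dots> = ennreal h * (\<integral>\<^sup>+y. G y \<partial>lborel)"
    using h by (subst nn_integral_multc) auto
  finally have main: "(\<integral>\<^sup>+y. ennreal (indicator D y * \<bar>w y\<bar>) \<partial>lborel) \<le> ennreal h * (\<integral>\<^sup>+y. G y \<partial>lborel)" .
  \<comment> \<open>Integrability on the bounded set allows the return from extended nonnegative
    integrals to real ones.\<close>
  have int: "integrable lborel (\<lambda>y. indicator D y * \<bar>f y\<bar>)" if "continuous_on UNIV f" for f :: "'a \<Rightarrow> real"
  proof -
    have "compact (closure D)" using D by simp
    then have "set_integrable lborel (closure D) (\<lambda>y. \<bar>f y\<bar>)"
      unfolding set_integrable_def
      by (rule borel_integrable_compact) (auto intro!: continuous_intros continuous_on_subset[OF that])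
    then have "set_integrable lborel D (\<lambda>y. \<bar>f y\<bar>)"
      by (rule set_integrable_subset) (auto simp: closure_subset)
    then show ?thesis by (simp add: set_integrable_def)
  qed
  have "(\<integral>\<^sup>+y. G y \<partial>lborel) = ennreal (LINT x:D|lborel. \<bar>w' x\<bar>)"
    unfolding G_def set_lebesgue_integral_def using int[OF cont]
    by (subst nn_integral_eq_integral) auto
  moreover have "(\<integral>\<^sup>+y. ennreal (indicator D y * \<bar>w y\<bar>) \<partial>lborel) = ennreal (LINT x:D|lborel. \<bar>w x\<bar>)"
    unfolding set_lebesgue_integral_def using int[OF contw]
    by (subst nn_integral_eq_integral) auto
  ultimately have "ennreal (LINT x:D|lborel. \<bar>w x\<bar>) \<le> ennreal (h * (LINT x:D|lborel. \<bar>w' x\<bar>))"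
    using main h by (simp add: ennreal_mult')
  moreover have "0 \<le> (LINT x:D|lborel. \<bar>w' x\<bar>)"
    unfolding set_lebesgue_integral_def by (intro integral_nonneg_AE) auto
  ultimately show ?thesis using h by (simp add: ennreal_le_iff)
qed

section \<open>Regularity and square integrability of the approximants\<close>

text \<open>Gradients are unique, so \<open>g\<close> coincides with the gradient supplied by
  \<open>C_k (Suc 0)\<close>, whose components are continuous.\<close>

lemma GDERIV_smooth_continuous:
  assumes "smooth w" and g: "\<And>x. GDERIV w x :> g x"
  shows "continuous_on UNIV g"
proof -
  have "C_k (Suc 0) w" using assms(1) unfolding smooth_def by blast
  then obtain g' where g': "\<And>x. GDERIV w x :> g' x" and c: "\<And>i. i \<in> Basis \<Longrightarrow> continuous_on UNIV (\<lambda>x. g' x \<bullet> i)"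
    by auto
  have "g x = g' x" for x
  proof (rule vector_eq_ldot[THEN iffD1], rule allI)
    fix h
    have "(\<lambda>h. h \<bullet> g x) = (\<lambda>h. h \<bullet> g' x)"
      using g[of x] g'[of x] unfolding gderiv_def by (rule has_derivative_unique)
    then show "h \<bullet> g x = h \<bullet> g' x" by (rule fun_cong)
  qed
  then have "g = g'" ..
  moreover have "continuous_on UNIV g'"
    using c by (subst continuous_on_componentwise) auto
  ultimately show ?thesis by simp
qed

text \<open>The square of a difference is dominated by twice the sum of the squares. This provides
  the integrability of the error terms in \<open>H1_0\<close>, without which their integrals could
  not be compared on subsets of the domain.\<close>

lemma L2_on_diff:
  fixes f g :: "'a::euclidean_space \<Rightarrow> 'b::euclidean_space"
  assumes f: "L2_on \<Omega> f" and g: "L2_on \<Omega> g"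
  shows "L2_on \<Omega> (\<lambda>x. f x - g x)"
proof -
  have fm [measurable]: "(\<lambda>x. indicator \<Omega> x *\<^sub>R f x) \<in> borel_measurable lebesgue"
    and gm [measurable]: "(\<lambda>x. indicator \<Omega> x *\<^sub>R g x) \<in> borel_measurable lebesgue"
    using f g by (auto simp: L2_on_def set_borel_measurable_def)
  have "(\<lambda>x. indicator \<Omega> x *\<^sub>R f x - indicator \<Omega> x *\<^sub>R g x) \<in> borel_measurable lebesgue" by measurable
  then have m: "(\<lambda>x. indicator \<Omega> x *\<^sub>R (f x - g x)) \<in> borel_measurable lebesgue"
    by (simp add: scaleR_diff_right)
  have eq: "indicator \<Omega> x *\<^sub>R (norm (f x - g x))\<^sup>2 = (norm (indicator \<Omega> x *\<^sub>R (f x - g x)))\<^sup>2" for x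
    by (simp add: indicator_def)
  have m2: "(\<lambda>x. indicator \<Omega> x *\<^sub>R (norm (f x - g x))\<^sup>2) \<in> borel_measurable lebesgue"
    unfolding eq using m by measurable
  have le: "(norm (f x - g x))\<^sup>2 \<le> 2 * (norm (f x))\<^sup>2 + 2 * (norm (g x))\<^sup>2" for x
  proof -
    have "(norm (f x - g x))\<^sup>2 \<le> (norm (f x) + norm (g x))\<^sup>2"
      by (intro power_mono norm_triangle_ineq4) auto
    also have "\<dots> \<le> 2 * (norm (f x))\<^sup>2 + 2 * (norm (g x))\<^sup>2"
      using sum_squares_bound[of "norm (f x)" "norm (g x)"] by (simp add: power2_sum)
    finally show ?thesis .
  qed
  have "integrable lebesgue (\<lambda>x. indicator \<Omega> x *\<^sub>R (norm (f x - g x))\<^sup>2)"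
  proof (rule Bochner_Integration.integrable_bound[OF _ m2])
    show "integrable lebesgue (\<lambda>x. 2 * (indicator \<Omega> x *\<^sub>R (norm (f x))\<^sup>2) + 2 * (indicator \<Omega> x *\<^sub>R (norm (g x))\<^sup>2))"
      using f g by (auto simp: L2_on_def set_integrable_def)
    show "AE x in lebesgue. norm (indicator \<Omega> x *\<^sub>R (norm (f x - g x))\<^sup>2)
        \<le> norm (2 * (indicator \<Omega> x *\<^sub>R (norm (f x))\<^sup>2) + 2 * (indicator \<Omega> x *\<^sub>R (norm (g x))\<^sup>2))"
      using le by (auto simp: indicator_def)
  qed
  then show ?thesis using m by (simp add: L2_on_def set_borel_measurable_def set_integrable_def)
qed

lemma set_integrable_continuous_bounded:
  fixes f :: "'a::euclidean_space \<Rightarrow> 'b::euclidean_space"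
  assumes "continuous_on UNIV f" and "S \<in> sets lebesgue" and "bounded S"
  shows "set_integrable lebesgue S f"
proof -
  have "set_integrable lebesgue (closure S) f"
    unfolding set_integrable_def using assms(3)
    by (subst integrable_completion)
       (auto intro!: borel_integrable_compact borel_measurable_continuous_onI[OF assms(1)] borel_measurable_indicator
         borel_measurable_scaleR continuous_on_subset[OF assms(1)])
  then show ?thesis by (rule set_integrable_subset) (auto simp: assms closure_subset)
qed

lemma L2_on_continuous_bounded:
  fixes f :: "'a::euclidean_space \<Rightarrow> 'b::euclidean_space"
  assumes f: "continuous_on UNIV f" and S: "S \<in> sets lebesgue" "bounded S"
  shows "L2_on S f"
proof -
  have [measurable]: "f \<in> borel_measurable lebesgue"
    by (intro measurable_completion) (auto intro: borel_measurable_continuous_onI f)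
  show ?thesis
    unfolding L2_on_def set_borel_measurable_def using S
    by (auto intro!: set_integrable_continuous_bounded continuous_intros f)
qed

section \<open>Vanishing traces on facets\<close>

text \<open>A Poincare inequality for the smooth approximants, passed to the limit. The constant is
  four times the squared norm of a weak gradient of \<open>u\<close>; it is fixed before the strip,
  so strips of all heights can be compared.\<close>

lemma H1_0_strip_measure_bound:
  fixes \<Omega> :: "'a::euclidean_space set"
  assumes u: "u \<in> H1_0 \<Omega> \<gamma>" and \<Omega>: "open \<Omega>" "bounded \<Omega>"
  obtains M where "\<And>D \<sigma> e h \<delta>. open D \<Longrightarrow> D \<subseteq> \<Omega> \<Longrightarrow> \<sigma> \<in> borel_measurable borel \<Longrightarrow>
      (\<And>y. y \<in> D \<Longrightarrow> 0 < \<sigma> y \<and> \<sigma> y \<le> h \<and> y - \<sigma> y *\<^sub>R e \<in> \<gamma>) \<Longrightarrow>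
      (\<And>y t. y \<in> D \<Longrightarrow> 0 \<le> t \<Longrightarrow> t < \<sigma> y \<Longrightarrow> y - t *\<^sub>R e \<in> D) \<Longrightarrow> 0 \<le> h \<Longrightarrow>
      (\<And>y. y \<in> D \<Longrightarrow> \<delta> \<le> \<bar>u y\<bar>) \<Longrightarrow> 0 < \<delta> \<Longrightarrow>
      \<delta>\<^sup>2 * measure lebesgue D \<le> h\<^sup>2 * (norm e)\<^sup>2 * M"
proof -
  from u obtain g w gw where uL: "L2_on \<Omega> u" and gL: "L2_on \<Omega> g"
    and sm: "\<And>n. smooth (w n)" and gr: "\<And>n x. GDERIV (w n) x :> gw n x" and w0: "\<And>n x. x \<in> \<gamma> \<Longrightarrow> w n x = 0"
    and lim1: "(\<lambda>n. LINT x:\<Omega>|lebesgue. (w n x - u x)\<^sup>2) \<longlonglongrightarrow> 0"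
    and lim2: "(\<lambda>n. LINT x:\<Omega>|lebesgue. (norm (gw n x - g x))\<^sup>2) \<longlonglongrightarrow> 0"
    unfolding H1_0_def H1_def by blast
  define a where "a n = (LINT x:\<Omega>|lebesgue. (w n x - u x)\<^sup>2)" for n
  define b where "b n = (LINT x:\<Omega>|lebesgue. (norm (gw n x - g x))\<^sup>2)" for n
  define M0 where "M0 = (LINT x:\<Omega>|lebesgue. (norm (g x))\<^sup>2)"
  have cgw: "continuous_on UNIV (gw n)" for n by (rule GDERIV_smooth_continuous[OF sm gr])
  have cw: "continuous_on UNIV (w n)" for n
    using gr unfolding gderiv_def by (auto intro!: continuous_at_imp_continuous_on has_derivative_continuous)
  have \<Omega>l: "\<Omega> \<in> sets lebesgue" using \<Omega> by auto
  have iu: "set_integrable lebesgue \<Omega> (\<lambda>x. (w n x - u x)\<^sup>2)" for n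
    using L2_on_diff[OF L2_on_continuous_bounded[OF cw \<Omega>l \<Omega>(2), of n] uL] by (simp add: L2_on_def)
  have ig: "set_integrable lebesgue \<Omega> (\<lambda>x. (norm (gw n x - g x))\<^sup>2)" for n
    using L2_on_diff[OF L2_on_continuous_bounded[OF cgw \<Omega>l \<Omega>(2), of n] gL] by (simp add: L2_on_def)
  have ig0: "set_integrable lebesgue \<Omega> (\<lambda>x. (norm (g x))\<^sup>2)"
    using gL by (simp add: L2_on_def)
  show thesis
  proof (rule that[of "4 * M0"])
    fix D :: "'a set" and \<sigma> e and h \<delta> :: real
    assume D: "open D" "D \<subseteq> \<Omega>" and \<sigma>m: "\<sigma> \<in> borel_measurable borel"
      and \<sigma>: "\<And>y. y \<in> D \<Longrightarrow> 0 < \<sigma> y \<and> \<sigma> y \<le> h \<and> y - \<sigma> y *\<^sub>R e \<in> \<gamma>"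
      and inD: "\<And>y t. y \<in> D \<Longrightarrow> 0 \<le> t \<Longrightarrow> t < \<sigma> y \<Longrightarrow> y - t *\<^sub>R e \<in> D" and h: "0 \<le> h"
      and \<delta>: "\<And>y. y \<in> D \<Longrightarrow> \<delta> \<le> \<bar>u y\<bar>" "0 < \<delta>"
    define K where "K = h\<^sup>2 * (norm e)\<^sup>2"
    have bD: "bounded D" using D \<Omega> bounded_subset by blast
    have Dl: "D \<in> sets lebesgue" using D by auto
    have mono: "(LINT x:D|lebesgue. f x) \<le> (LINT x:\<Omega>|lebesgue. f x)"
      if "set_integrable lebesgue \<Omega> f" "\<And>x. 0 \<le> f x" for f :: "'a \<Rightarrow> real"
      unfolding set_lebesgue_integral_def using that(2) D(2) set_integrable_subset[OF that(1) Dl D(2)] that(1)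
      by (intro integral_mono) (auto simp: set_integrable_def indicator_def)
    have sub: "set_integrable lebesgue D f" if "set_integrable lebesgue \<Omega> f" for f :: "'a \<Rightarrow> real"
      using set_integrable_subset[OF that Dl D(2)] .
    have int: "set_integrable lebesgue D f" if "continuous_on UNIV f" for f :: "'a \<Rightarrow> real"
      by (rule set_integrable_continuous_bounded[OF that Dl bD])
    have conv: "(LINT x:D|lebesgue. f x) = (LINT x:D|lborel. f x)" if "continuous_on UNIV f" for f :: "'a \<Rightarrow> real"
    proof -
      have [measurable]: "f \<in> borel_measurable borel" "D \<in> sets borel"
        using that D by (auto intro: borel_measurable_continuous_onI)
      show ?thesis unfolding set_lebesgue_integral_def by (intro integral_completion) measurable
    qed
    have cst: "(LINT x:D|lebesgue. c) = c * measure lebesgue D" for c :: real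
      using bD Dl by (simp add: set_lebesgue_integral_def)
    \<comment> \<open>The strip estimate is one for absolute values; Young's inequality on both of
      its sides converts it to squares. The lower bound costs a quarter of \<open>\<delta>\<close>
      and the upper bound another quarter, so half of \<open>\<delta>\<close> remains, which
      explains the factors 2 and 4.\<close>
    have "\<delta>\<^sup>2 * measure lebesgue D \<le> 2 * a n + 4 * K * (b n + M0)" for n
    proof -
      define w' where "w' x = gw n x \<bullet> e" for x
      have cw': "continuous_on UNIV w'" unfolding w'_def by (intro continuous_intros cgw)
      have "((\<lambda>t. w n (x + t *\<^sub>R e)) has_real_derivative w' x) (at 0)" for x
      proof -
        have 1: "(w n has_derivative (\<lambda>h. h \<bullet> gw n x)) (at (x + 0 *\<^sub>R e))"
          using gr[of n x] by (simp add: gderiv_def)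
        have 2: "((\<lambda>t. x + t *\<^sub>R e) has_derivative (\<lambda>t. t *\<^sub>R e)) (at 0)"
          by (auto intro!: derivative_eq_intros)
        show ?thesis
          using has_derivative_compose[OF 2 1]
          by (simp add: has_field_derivative_def w'_def inner_commute mult.commute[of _ "gw n x \<bullet> e"] mult_commute_abs)
      qed
      then have "(LINT x:D|lborel. \<bar>w n x\<bar>) \<le> h * (LINT x:D|lborel. \<bar>w' x\<bar>)"
        using \<sigma> inD h D bD by (intro directional_derivative_strip_bound[where \<sigma>=\<sigma> and e=e] cw' cw) (auto intro: w0)
      then have strip: "(LINT x:D|lebesgue. \<bar>w n x\<bar>) \<le> (LINT x:D|lebesgue. h * \<bar>w' x\<bar>)"
        using cw cw' by (subst (1 2) conv) (auto intro!: continuous_intros)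
      have i1: "set_integrable lebesgue D (\<lambda>x. \<bar>w n x\<bar>)" "set_integrable lebesgue D (\<lambda>x. h * \<bar>w' x\<bar>)"
        "set_integrable lebesgue D (\<lambda>x. c)" for c :: real
        by (intro int continuous_intros cw cw')+
      have i2: "set_integrable lebesgue D (\<lambda>x. (1/\<delta>) * (w n x - u x)\<^sup>2)"
        by (intro set_integrable_mult_right sub iu)
      have i3: "set_integrable lebesgue D (\<lambda>x. (norm (gw n x - g x))\<^sup>2)" "set_integrable lebesgue D (\<lambda>x. (norm (g x))\<^sup>2)"
        by (intro sub ig ig0)+
      have i4: "set_integrable lebesgue D (\<lambda>x. (2*K/\<delta>) * ((norm (gw n x - g x))\<^sup>2 + (norm (g x))\<^sup>2))"
        by (intro set_integrable_mult_right set_integral_add i3)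
      have "(LINT x:D|lebesgue. 3/4 * \<delta>) \<le> (LINT x:D|lebesgue. \<bar>w n x\<bar> + (1/\<delta>) * (w n x - u x)\<^sup>2)"
      proof (rule set_integral_mono)
        fix x assume x: "x \<in> D"
        \<comment> \<open>Young's inequality in the form
          \<open>t \<le> \<delta>/4 + t^2/\<delta>\<close>, which is
          \<open>(t - \<delta>/2)^2 \<ge> 0\<close> divided by \<open>\<delta>\<close>.\<close>
        have "\<bar>w n x - u x\<bar> \<le> \<delta>/4 + (1/\<delta>) * (w n x - u x)\<^sup>2"
        proof -
          have "\<bar>w n x - u x\<bar> * \<delta> \<le> \<delta>\<^sup>2/4 + (w n x - u x)\<^sup>2"
            using zero_le_power2[of "\<bar>w n x - u x\<bar> - \<delta>/2"] by (simp add: power2_eq_square algebra_simps)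
          then show ?thesis using \<delta>(2) by (simp add: field_simps power2_eq_square)
        qed
        then show "3/4 * \<delta> \<le> \<bar>w n x\<bar> + (1/\<delta>) * (w n x - u x)\<^sup>2"
          using \<delta>(1)[OF x] by linarith
      qed (intro set_integral_add i1 i2)+
      also have "\<dots> = (LINT x:D|lebesgue. \<bar>w n x\<bar>) + (1/\<delta>) * (LINT x:D|lebesgue. (w n x - u x)\<^sup>2)"
        by (subst set_integral_add(2)[OF i1(1) i2]) simp
      also have "\<dots> \<le> (LINT x:D|lebesgue. h * \<bar>w' x\<bar>) + (1/\<delta>) * a n"
        unfolding a_def using strip \<delta> by (intro add_mono mult_left_mono mono iu) auto
      finally have lower: "3/4 * \<delta> * measure lebesgue D \<le> (LINT x:D|lebesgue. h * \<bar>w' x\<bar>) + (1/\<delta>) * a n"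
        by (simp add: cst mult_ac)
      \<comment> \<open>The same inequality with \<open>t = h * norm e * norm (gw n x)\<close>; the
        approximating gradient is then split into its error and the limit gradient
        \<open>g\<close>.\<close>
      have "(LINT x:D|lebesgue. h * \<bar>w' x\<bar>) \<le> (LINT x:D|lebesgue. \<delta>/4 + (2*K/\<delta>) * ((norm (gw n x - g x))\<^sup>2 + (norm (g x))\<^sup>2))"
      proof (rule set_integral_mono)
        fix x assume x: "x \<in> D"
        define z where "z = h * norm e * norm (gw n x)"
        have "h * \<bar>w' x\<bar> \<le> z"
          unfolding w'_def z_def using h Cauchy_Schwarz_ineq2[of "gw n x" e]
          by (simp add: mult_left_mono mult.assoc mult.commute[of "norm e"])
        also have "z \<le> \<delta>/4 + (1/\<delta>) * z\<^sup>2"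
        proof -
          have "z * \<delta> \<le> \<delta>\<^sup>2/4 + z\<^sup>2"
            using zero_le_power2[of "z - \<delta>/2"] by (simp add: power2_eq_square algebra_simps)
          then show ?thesis using \<delta>(2) by (simp add: field_simps power2_eq_square)
        qed
        also have "z\<^sup>2 \<le> K * (2 * ((norm (gw n x - g x))\<^sup>2 + (norm (g x))\<^sup>2))"
        proof -
          have "norm (gw n x) \<le> norm (gw n x - g x) + norm (g x)"
            using norm_triangle_ineq[of "gw n x - g x" "g x"] by simp
          then have "(norm (gw n x))\<^sup>2 \<le> (norm (gw n x - g x) + norm (g x))\<^sup>2"
            by (intro power_mono) auto
          also have "\<dots> \<le> 2 * ((norm (gw n x - g x))\<^sup>2 + (norm (g x))\<^sup>2)"
            using sum_squares_bound[of "norm (gw n x - g x)" "norm (g x)"] by (simp add: power2_sum)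
          finally show ?thesis unfolding z_def K_def power_mult_distrib by (intro mult_left_mono) auto
        qed
        finally show "h * \<bar>w' x\<bar> \<le> \<delta>/4 + (2*K/\<delta>) * ((norm (gw n x - g x))\<^sup>2 + (norm (g x))\<^sup>2)"
          using \<delta>(2) by (simp add: field_simps)
      qed (intro set_integral_add i1 i4)+
      also have "\<dots> = \<delta>/4 * measure lebesgue D + (2*K/\<delta>) * ((LINT x:D|lebesgue. (norm (gw n x - g x))\<^sup>2) + (LINT x:D|lebesgue. (norm (g x))\<^sup>2))"
        by (subst set_integral_add(2)[OF i1(3) i4]) (simp add: cst set_integral_add(2)[OF i3])
      also have "\<dots> \<le> \<delta>/4 * measure lebesgue D + (2*K/\<delta>) * (b n + M0)"
        unfolding b_def M0_def K_def using \<delta> by (intro add_left_mono mult_left_mono add_mono mono ig ig0) auto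
      finally have "3/4 * \<delta> * measure lebesgue D \<le> \<delta>/4 * measure lebesgue D + (2*K/\<delta>) * (b n + M0) + (1/\<delta>) * a n"
        using lower by simp
      then have "\<delta> * (3/4 * \<delta> * measure lebesgue D)
          \<le> \<delta> * (\<delta>/4 * measure lebesgue D + (2*K/\<delta>) * (b n + M0) + (1/\<delta>) * a n)"
        using \<delta>(2) by (intro mult_left_mono) auto
      also have "\<dots> = \<delta>\<^sup>2 * measure lebesgue D / 4 + 2*K * (b n + M0) + a n"
        using \<delta>(2) by (simp add: field_simps power2_eq_square)
      finally show ?thesis by (simp add: power2_eq_square)
    qed
    \<comment> \<open>Both approximation errors tend to 0, and only the energy of \<open>g\<close>
      survives.\<close>
    moreover have "(\<lambda>n. 2 * a n + 4 * K * (b n + M0)) \<longlonglongrightarrow> 2 * 0 + 4 * K * (0 + M0)"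
      using lim1 lim2 unfolding a_def b_def by (intro tendsto_intros) auto
    ultimately have "\<delta>\<^sup>2 * measure lebesgue D \<le> 2 * 0 + 4 * K * (0 + M0)"
      by (intro LIMSEQ_le_const) auto
    then show "\<delta>\<^sup>2 * measure lebesgue D \<le> h\<^sup>2 * (norm e)\<^sup>2 * (4 * M0)"
      by (simp add: K_def algebra_simps)
  qed
qed

text \<open>The points to exclude may be taken in the relative interior of \<open>F\<close>, since
  the zero set of an affine function is closed. Over such a point, oblique cylinders of height
  \<open>1/n\<close> with base in \<open>F\<close> fit into \<open>T\<close>; their volume is at
  least of order \<open>1/n\<close>, against the upper bound of order \<open>1/n^2\<close> for
  strips.\<close>

lemma H1_0_affine_vanishes_on_facet:
  fixes \<Omega> :: "'a::euclidean_space set"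
  assumes u: "u \<in> H1_0 \<Omega> \<gamma>" and \<Omega>: "open \<Omega>" "bounded \<Omega>"
    and T: "convex T" "closed T" "interior T \<noteq> {}" "interior T \<subseteq> \<Omega>"
    and F: "F facet_of T" "F \<subseteq> \<gamma>"
    and aff: "\<And>y. y \<in> T \<Longrightarrow> u y = \<alpha> \<bullet> y + \<beta>"
    and x: "x \<in> F"
  shows "u x = 0"
proof -
  have fT: "F face_of T" and FT: "F \<subseteq> T" and dF: "aff_dim F = aff_dim T - 1"
    using F(1) by (auto simp: facet_of_def face_of_imp_subset)
  have cF: "convex F" using fT by (rule face_of_imp_convex)
  have "F \<noteq> T" using dF by auto
  have "aff_dim T = int DIM('a)" using T(3) by (metis low_dim_interior)
  then have "aff_dim F = int DIM('a) - 1" using dF by simp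
  then obtain a b where a: "a \<noteq> 0" and hull: "affine hull F = {y. a \<bullet> y = b}"
    using aff_dim_eq_hyperplane[of F] DIM_positive[where 'a='a] by (auto simp: of_nat_diff)
  obtain M where M: "\<And>D \<sigma> e h \<delta>. open D \<Longrightarrow> D \<subseteq> \<Omega> \<Longrightarrow> \<sigma> \<in> borel_measurable borel \<Longrightarrow>
      (\<And>y. y \<in> D \<Longrightarrow> 0 < \<sigma> y \<and> \<sigma> y \<le> h \<and> y - \<sigma> y *\<^sub>R e \<in> \<gamma>) \<Longrightarrow>
      (\<And>y t. y \<in> D \<Longrightarrow> 0 \<le> t \<Longrightarrow> t < \<sigma> y \<Longrightarrow> y - t *\<^sub>R e \<in> D) \<Longrightarrow> 0 \<le> h \<Longrightarrow>
      (\<And>y. y \<in> D \<Longrightarrow> \<delta> \<le> \<bar>u y\<bar>) \<Longrightarrow> 0 < \<delta> \<Longrightarrow>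
      \<delta>\<^sup>2 * measure lebesgue D \<le> h\<^sup>2 * (norm e)\<^sup>2 * M"
    using H1_0_strip_measure_bound[OF u \<Omega>] by blast
  have int0: "\<alpha> \<bullet> x0 + \<beta> = 0" if x0: "x0 \<in> rel_interior F" for x0
  proof (rule ccontr)
    assume ne: "\<alpha> \<bullet> x0 + \<beta> \<noteq> 0"
    define \<delta> where "\<delta> = \<bar>\<alpha> \<bullet> x0 + \<beta>\<bar> / 2"
    have \<delta>: "0 < \<delta>" "\<delta> < \<bar>\<alpha> \<bullet> x0 + \<beta>\<bar>" using ne by (auto simp: \<delta>_def)
    have x0F: "x0 \<in> F" using x0 rel_interior_subset by blast
    have "open {y. \<delta> < \<bar>\<alpha> \<bullet> y + \<beta>\<bar>}"
      by (intro open_Collect_less continuous_intros)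
    then obtain \<epsilon> where \<epsilon>: "\<epsilon> > 0" "ball x0 \<epsilon> \<subseteq> {y. \<delta> < \<bar>\<alpha> \<bullet> y + \<beta>\<bar>}"
      using \<delta> by (metis (mono_tags, lifting) mem_Collect_eq open_contains_ball)
    obtain r0 where r0: "r0 > 0" "ball x0 r0 \<inter> affine hull F \<subseteq> F"
      using x0 by (auto simp: mem_rel_interior_ball)
    have "x0 \<in> closure (interior T)"
      using convex_closure_interior[OF T(1,3)] x0F FT closure_subset by blast
    then obtain c where c: "c \<in> interior T" "dist c x0 < \<epsilon>/2"
      using \<epsilon>(1) by (meson closure_approachable half_gt_zero)
    then obtain r1 where r1: "r1 > 0" "ball c r1 \<subseteq> T"
      by (auto simp: mem_interior)
    define r where "r = min (min r0 r1) (\<epsilon>/2)"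
    have r: "r > 0" "r \<le> r0" "r \<le> r1" "r \<le> \<epsilon>/2" using r0 r1 \<epsilon> by (auto simp: r_def)
    \<comment> \<open>The axis of the cylinders runs from the facet to an interior point
      \<open>c\<close>: the base shifted by \<open>e\<close> lies in a ball about \<open>c\<close>
      inside \<open>T\<close>, and convexity then keeps the whole cylinder in
      \<open>T\<close>.\<close>
    define e where "e = c - x0"
    have ax0: "a \<bullet> x0 = b" using x0F hull hull_subset[of F affine] by blast
    have "c \<notin> F" using face_of_disjoint_interior[OF fT \<open>F \<noteq> T\<close>] c by blast
    then have "c \<notin> affine hull F"
      using face_of_imp_eq_affine_Int[OF T(1) fT] c interior_subset by blast
    then have ae: "a \<bullet> e \<noteq> 0" using hull ax0 by (auto simp: e_def inner_diff_right)
    \<comment> \<open>The parameter of the oblique projection along \<open>e\<close> onto the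
      hyperplane spanned by \<open>F\<close>; the foot \<open>z = y - \<sigma> y *\<^sub>R e\<close>
      satisfies \<open>a \<bullet> z = b\<close>.\<close>
    define \<sigma> where "\<sigma> y = (a \<bullet> y - b) / (a \<bullet> e)" for y
    have \<sigma>_shift: "\<sigma> (y - t *\<^sub>R e) = \<sigma> y - t" for y t
      using ae by (simp add: \<sigma>_def inner_diff_right diff_divide_distrib)
    \<comment> \<open>The open cylinder of height \<open>h\<close> over a disc of radius
      \<open>r\<close> about \<open>x0\<close>. The bound \<open>r \<le> r0\<close> puts feet in
      \<open>F\<close>, \<open>r \<le> r1\<close> puts the top in \<open>T\<close>, and
      \<open>r \<le> \<epsilon>/2\<close> with \<open>norm e < \<epsilon>/2\<close> keeps the
      cylinder where the affine function exceeds \<open>\<delta>\<close> in modulus.\<close>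
    define D where "D h = {y. 0 < \<sigma> y \<and> \<sigma> y < h \<and> dist x0 (y - \<sigma> y *\<^sub>R e) < r}" for h
    have c\<sigma>: "continuous_on UNIV \<sigma>" unfolding \<sigma>_def using ae by (intro continuous_intros) auto
    have oD: "open (D h)" for h
      unfolding D_def by (intro open_Collect_conj open_Collect_less continuous_intros c\<sigma>)
    have foot: "y - \<sigma> y *\<^sub>R e \<in> F" if "y \<in> D h" for y h
    proof -
      have "a \<bullet> (y - \<sigma> y *\<^sub>R e) = b" using ae by (simp add: \<sigma>_def inner_diff_right)
      then have "y - \<sigma> y *\<^sub>R e \<in> ball x0 r0 \<inter> affine hull F"
        using that r unfolding hull by (auto simp: D_def)
      then show ?thesis using r0 by blast
    qed
    have DT: "y \<in> T" "dist x0 y < \<epsilon>" if y: "y \<in> D h" and h: "h \<le> 1" for y h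
    proof -
      define z where "z = y - \<sigma> y *\<^sub>R e"
      have s: "0 < \<sigma> y" "\<sigma> y \<le> 1" using y h by (auto simp: D_def)
      have z: "z \<in> T" "dist x0 z < r" using foot[OF y] FT y by (auto simp: z_def D_def)
      have "z + e \<in> ball c r1" using z(2) r by (simp add: e_def dist_norm algebra_simps)
      then have "z + e \<in> T" using r1 by blast
      then have "(1 - \<sigma> y) *\<^sub>R z + \<sigma> y *\<^sub>R (z + e) \<in> T"
        using T(1) z(1) s by (intro convexD) auto
      then show "y \<in> T" by (simp add: z_def algebra_simps)
      have "dist x0 y \<le> dist x0 z + dist z y" by (rule dist_triangle)
      also have "dist z y = \<sigma> y * norm e" using s by (simp add: z_def dist_norm)
      also have "\<dots> \<le> 1 * norm e" using s by (intro mult_right_mono) auto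
      also have "norm e < \<epsilon>/2" using c(2) by (simp add: e_def dist_norm)
      finally show "dist x0 y < \<epsilon>" using z(2) r by simp
    qed
    have bound: "\<delta>\<^sup>2 * measure lebesgue (D h) \<le> h\<^sup>2 * (norm e)\<^sup>2 * M" if h: "0 < h" "h \<le> 1" for h
    proof (rule M)
      show "open (D h)" by (rule oD)
      show "D h \<subseteq> \<Omega>" using interior_maximal[of "D h" T] oD DT h T(4) by blast
      show "\<sigma> \<in> borel_measurable borel" by (rule borel_measurable_continuous_onI[OF c\<sigma>])
      show "0 < \<sigma> y \<and> \<sigma> y \<le> h \<and> y - \<sigma> y *\<^sub>R e \<in> \<gamma>" if "y \<in> D h" for y
        using that foot[OF that] F(2) by (auto simp: D_def)
      show "y - t *\<^sub>R e \<in> D h" if "y \<in> D h" "0 \<le> t" "t < \<sigma> y" for y t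
        using that by (auto simp: D_def \<sigma>_shift algebra_simps)
      show "\<delta> \<le> \<bar>u y\<bar>" if "y \<in> D h" for y
        using DT[OF that h(2)] \<epsilon>(2) aff[of y] by force
    qed (use h \<delta> in auto)
    have bD: "bounded (D h)" if "h \<le> 1" for h
      using DT(2)[OF _ that] by (intro bounded_subset[OF bounded_ball[of x0 \<epsilon>]]) auto
    have lD: "D h \<in> lmeasurable" if "h \<le> 1" for h
      using bD[OF that] oD[of h] by (simp add: lmeasurable_open)
    have "x0 + (1/2) *\<^sub>R e \<in> D 1"
      using ae ax0 r by (simp add: D_def \<sigma>_def inner_add_right)
    then have pos: "measure lebesgue (D 1) > 0"
      using open_not_negligible[OF oD[of 1]] negligible_iff_measure0[OF lD[of 1]]
      by (metis empty_iff order_refl zero_less_measure_iff)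
    have "\<delta>\<^sup>2 * measure lebesgue (D 1) * real n \<le> 2 * (norm e)\<^sup>2 * M" if n: "n > 0" for n :: nat
    proof -
      \<comment> \<open>Shifts by multiples of \<open>1/(2n)\<close> of a cylinder of height
        \<open>1/n\<close> overlap, so that these open sets cover \<open>D 1\<close> without gaps.
        This gives \<open>\<bar>D 1\<bar> \<le> 2 n \<bar>D (1/n)\<bar>\<close> for the
        volumes.\<close>
      let ?D = "\<lambda>k. (+) ((real k / (2 * real n)) *\<^sub>R e) ` D (1 / real n)"
      have n1: "1 / real n \<le> 1" using n by simp
      have cover: "D 1 \<subseteq> (\<Union>k<2*n. ?D k)"
      proof
        fix y assume y: "y \<in> D 1"
        \<comment> \<open>Ceiling minus one instead of floor: the remainder
          \<open>\<sigma> y - k/(2n)\<close> must be strictly positive, as the cylinder is open at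
          its base.\<close>
        define k where "k = nat (\<lceil>\<sigma> y * (2 * real n)\<rceil> - 1)"
        have s: "0 < \<sigma> y * (2 * real n)" "\<sigma> y * (2 * real n) < 1 * (2 * real n)"
          using y n by (auto simp: D_def)
        then have k1: "real k = real_of_int \<lceil>\<sigma> y * (2 * real n)\<rceil> - 1"
          unfolding k_def by simp
        then have k: "real k < \<sigma> y * (2 * real n)" "\<sigma> y * (2 * real n) \<le> real k + 1" by linarith+
        then have "real k < real (2 * n)" using s by simp
        then have kn: "k < 2 * n" by linarith
        have "\<sigma> y \<le> (real k + 1) / (2 * real n)"
          using k(2) n by (simp add: pos_le_divide_eq)
        then have "\<sigma> y - real k / (2 * real n) \<le> 1 / (2 * real n)"
          by (simp add: add_divide_distrib)
        also have "\<dots> < 1 / real n" using n by (simp add: field_simps)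
        finally have "real k / (2 * real n) < \<sigma> y" "\<sigma> y - real k / (2 * real n) < 1 / real n"
          using k(1) n by (simp_all add: field_simps)
        then have "y - (real k / (2 * real n)) *\<^sub>R e \<in> D (1 / real n)"
          using y by (auto simp: D_def \<sigma>_shift algebra_simps)
        then have "y \<in> ?D k" by (intro image_eqI[of _ _ "y - (real k / (2 * real n)) *\<^sub>R e"]) auto
        then show "y \<in> (\<Union>k<2*n. ?D k)" using kn by blast
      qed
      have "measure lebesgue (D 1) \<le> measure lebesgue (\<Union>k<2*n. ?D k)"
        using lD[OF n1] by (intro measure_mono_fmeasurable cover fmeasurable.finite_UN)
          (auto intro: measurable_translation lmeasurable_open simp: oD)
      also have "\<dots> \<le> (\<Sum>k<2*n. measure lebesgue (?D k))"
        using lD[OF n1] by (intro measure_UNION_le) (auto intro: measurable_translation fmeasurableD)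
      also have "\<dots> = 2 * real n * measure lebesgue (D (1 / real n))"
        by (simp add: measure_translation)
      finally have "\<delta>\<^sup>2 * measure lebesgue (D 1) * real n \<le> \<delta>\<^sup>2 * (2 * real n * measure lebesgue (D (1 / real n))) * real n"
        using n by (intro mult_right_mono mult_left_mono) auto
      also have "\<dots> = 2 * (real n)\<^sup>2 * (\<delta>\<^sup>2 * measure lebesgue (D (1 / real n)))"
        by (simp add: power2_eq_square)
      also have "\<dots> \<le> 2 * (real n)\<^sup>2 * ((1 / real n)\<^sup>2 * (norm e)\<^sup>2 * M)"
        using bound[of "1 / real n"] n by (intro mult_left_mono) auto
      also have "\<dots> = 2 * (norm e)\<^sup>2 * M" using n by (simp add: power_divide)
      finally show ?thesis .
    qed
    moreover obtain n :: nat where "2 * (norm e)\<^sup>2 * M < real n * (\<delta>\<^sup>2 * measure lebesgue (D 1))"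
      using reals_Archimedean3[of "\<delta>\<^sup>2 * measure lebesgue (D 1)"] pos \<delta> by auto
    \<comment> \<open>The Archimedean \<open>n\<close> may be 0, whereas the covering estimate needs
      a positive number; the successor serves.\<close>
    moreover obtain m :: nat where "0 < m" "2 * (norm e)\<^sup>2 * M < real m * (\<delta>\<^sup>2 * measure lebesgue (D 1))"
    proof -
      have "real n * (\<delta>\<^sup>2 * measure lebesgue (D 1)) \<le> real (Suc n) * (\<delta>\<^sup>2 * measure lebesgue (D 1))"
        by (intro mult_right_mono) auto
      then show ?thesis using that[of "Suc n"] calculation(2) by linarith
    qed
    ultimately show False by (auto simp: mult.commute not_less[symmetric])
  qed
  have "closed {y. \<alpha> \<bullet> y + \<beta> = 0}" by (intro closed_Collect_eq continuous_intros)
  then have "closure (rel_interior F) \<subseteq> {y. \<alpha> \<bullet> y + \<beta> = 0}"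
    using int0 by (intro closure_minimal) auto
  then have "\<alpha> \<bullet> x + \<beta> = 0"
    using x closure_subset[of F] convex_closure_rel_interior[OF cF] by auto
  then show ?thesis using aff FT x by auto
qed

section \<open>Integrals of affine functions over corner simplices\<close>

lemma set_integrable_bounded_borel:
  fixes f :: "'a::euclidean_space \<Rightarrow> real"
  assumes "f \<in> borel_measurable borel" and S: "S \<in> lmeasurable" and B: "\<And>x. x \<in> S \<Longrightarrow> \<bar>f x\<bar> \<le> B"
  shows "set_integrable lebesgue S f"
proof -
  have [measurable]: "f \<in> borel_measurable lebesgue" "S \<in> sets lebesgue"
    using assms by (auto intro: measurable_completion)
  have "integrable lebesgue (\<lambda>x. indicator S x *\<^sub>R B)"
    using S by (intro integrable_scaleR_left) (auto simp: fmeasurable_def)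
  moreover have "(\<lambda>x. indicator S x *\<^sub>R f x) \<in> borel_measurable lebesgue" by measurable
  ultimately show ?thesis
    unfolding set_integrable_def
    by (rule Bochner_Integration.integrable_bound) (use B in \<open>fastforce simp: indicator_def\<close>)
qed

text \<open>The homothety as a translation after a scaling, the form needed for the affine change of
  variables.\<close>

lemma corner_simplex_eq: "corner_simplex K \<nu> = (\<lambda>x. (1/2) *\<^sub>R \<nu> + (1/2) *\<^sub>R x) ` K"
  unfolding corner_simplex_def by (rule image_cong) (auto simp: algebra_simps simp flip: scaleR_left_distrib)

text \<open>The homothety scales volume by \<open>(1/2)^d\<close> and sends \<open>x\<close> to the
  midpoint of \<open>\<nu>\<close> and \<open>x\<close>, where an affine \<open>p\<close> takes the
  mean of its two values. Hence \<open>2^(d+1)\<close> times the corner integral is the integral of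
  \<open>p \<nu> + p x\<close> over \<open>K\<close>, and the subtraction removes the second
  term.\<close>

lemma corner_simplex_integral_affine:
  fixes K :: "'a::euclidean_space set"
  assumes K: "compact K"
  shows "2 ^ (DIM('a) + 1) * (LINT x:corner_simplex K \<nu>|lebesgue. \<alpha> \<bullet> x + \<beta>) - (LINT x:K|lebesgue. \<alpha> \<bullet> x + \<beta>)
    = (\<alpha> \<bullet> \<nu> + \<beta>) * measure lebesgue K"
proof -
  let ?p = "\<lambda>x. \<alpha> \<bullet> x + \<beta>"
  let ?h = "\<lambda>x. (1/2) *\<^sub>R \<nu> + (1/2) *\<^sub>R x"
  note corner = corner_simplex_eq[of K \<nu>]
  have "compact (?h ` K)"
    using K by (intro compact_continuous_image continuous_intros)
  then have [measurable]: "?h ` K \<in> sets borel" "K \<in> sets borel" using K by (auto intro: borel_compact)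
  have [measurable]: "?p \<in> borel_measurable borel" by measurable
  define f where "f x = indicator (?h ` K) x *\<^sub>R ?p x" for x
  have fm [measurable]: "f \<in> borel_measurable borel" unfolding f_def by measurable
  have inj: "?h x \<in> ?h ` K \<longleftrightarrow> x \<in> K" for x by auto
  have fh: "f (?h x) = 1/2 * (indicator K x *\<^sub>R (?p \<nu>)) + 1/2 * (indicator K x *\<^sub>R ?p x)" for x
  proof -
    have "indicator (?h ` K) (?h x) = (indicator K x :: real)" unfolding indicator_def inj ..
    then show ?thesis unfolding f_def by (simp add: indicator_def inner_add_right field_simps)
  qed
  have iK: "integrable lborel (\<lambda>x. indicator K x *\<^sub>R g x)" if "continuous_on UNIV g" for g :: "'a \<Rightarrow> real"
    using K that continuous_on_subset by (blast intro: borel_integrable_compact)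
  have i: "integrable lborel (\<lambda>x. indicator K x *\<^sub>R (?p \<nu>))" "integrable lborel (\<lambda>x. indicator K x *\<^sub>R ?p x)"
    by (intro iK continuous_intros)+
  have "(LINT x:corner_simplex K \<nu>|lebesgue. ?p x) = integral\<^sup>L lborel f"
    unfolding corner set_lebesgue_integral_def f_def by (rule integral_completion) measurable
  also have "\<dots> = integral\<^sup>L (density (distr lborel borel ?h) (\<lambda>_. ennreal (\<bar>1/2\<bar> ^ DIM('a)))) f"
    using lborel_affine[of "1/2" "(1/2) *\<^sub>R \<nu>"] by (simp add: ennreal_power)
  also have "\<dots> = integral\<^sup>L (distr lborel borel ?h) (\<lambda>x. (1/2) ^ DIM('a) *\<^sub>R f x)"
    by (subst integral_density) auto
  also have "\<dots> = (LINT x|lborel. (1/2) ^ DIM('a) *\<^sub>R f (?h x))"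
    by (subst integral_distr) auto
  also have "\<dots> = (1/2) ^ DIM('a) * (1/2 * (LINT x:K|lborel. ?p \<nu>) + 1/2 * (LINT x:K|lborel. ?p x))"
    unfolding fh set_lebesgue_integral_def using i
    by (simp only: Bochner_Integration.integral_add integrable_mult_right integral_mult_right_zero
        integral_scaleR_right real_scaleR_def[of "(1/2) ^ DIM('a)"])
  also have "(LINT x:K|lborel. ?p \<nu>) = ?p \<nu> * measure lebesgue K"
    by (simp add: set_lebesgue_integral_def measure_completion)
  also have "(LINT x:K|lborel. ?p x) = (LINT x:K|lebesgue. ?p x)"
    unfolding set_lebesgue_integral_def by (rule integral_completion[symmetric]) measurable
  finally show ?thesis by (simp add: power_divide field_simps)
qed

section \<open>Affine functions and interiors of simplices\<close>

text \<open>The points that satisfy both bounds form an intersection of two halfspaces, hence a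
  convex set. Vertex values thereby control an affine function on its simplex.\<close>

lemma affine_function_hull_bounds:
  fixes \<alpha> :: "'a::real_inner"
  assumes "\<And>v. v \<in> C \<Longrightarrow> l \<le> \<alpha> \<bullet> v + \<beta> \<and> \<alpha> \<bullet> v + \<beta> \<le> (h::real)" and "x \<in> convex hull C"
  shows "l \<le> \<alpha> \<bullet> x + \<beta> \<and> \<alpha> \<bullet> x + \<beta> \<le> h"
proof -
  have "{x. l \<le> \<alpha> \<bullet> x + \<beta> \<and> \<alpha> \<bullet> x + \<beta> \<le> h} = {x. \<alpha> \<bullet> x \<ge> l - \<beta>} \<inter> {x. \<alpha> \<bullet> x \<le> h - \<beta>}"
    by auto
  then have "convex {x. l \<le> \<alpha> \<bullet> x + \<beta> \<and> \<alpha> \<bullet> x + \<beta> \<le> h}"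
    by (simp add: convex_Int convex_halfspace_ge convex_halfspace_le)
  then have "convex hull C \<subseteq> {x. l \<le> \<alpha> \<bullet> x + \<beta> \<and> \<alpha> \<bullet> x + \<beta> \<le> h}"
    using assms(1) by (intro hull_minimal) auto
  then show ?thesis using assms(2) by blast
qed

lemma full_simplex_interior:
  fixes T :: "'a::euclidean_space set"
  assumes "int DIM('a) simplex T"
  shows "interior T \<noteq> {}"
proof -
  have "aff_dim T = int DIM('a)" using assms by (rule aff_dim_simplex)
  moreover from this have "T \<noteq> {}" by auto
  ultimately show ?thesis
    using rel_interior_eq_empty[OF convex_simplex[OF assms]] interior_rel_interior_gen[of T] by simp
qed

section \<open>Conforming meshes and red-refinements\<close>

locale conforming_mesh =
  fixes \<Omega> :: "'a::euclidean_space set" and \<T> :: "'a set set"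
  assumes open_dom: "open \<Omega>" and bounded_dom: "bounded \<Omega>"
    and conforming: "conforming_partition \<Omega> \<T>"
begin

lemma finite_mesh: "finite \<T>"
  using conforming by (auto simp: conforming_partition_def triangulation_def)

lemma simplex_mesh: "T \<in> \<T> \<Longrightarrow> int DIM('a) simplex T"
  using conforming by (auto simp: conforming_partition_def)

lemmas convex_mesh = convex_simplex[OF simplex_mesh]
  and compact_mesh = compact_simplex[OF simplex_mesh]
  and interior_mesh = full_simplex_interior[OF simplex_mesh]

lemma interior_mesh_subset: "T \<in> \<T> \<Longrightarrow> interior T \<subseteq> \<Omega>"
  using conforming by (auto simp: conforming_partition_def)

lemma closure_interior_mesh: "T \<in> \<T> \<Longrightarrow> closure (interior T) = T"
  using convex_closure_interior[OF convex_mesh interior_mesh, of T] compact_mesh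
  by (simp add: compact_imp_closed)

lemma interior_lmeasurable: "T \<in> \<T> \<Longrightarrow> interior T \<in> lmeasurable"
  by (simp add: compact_imp_bounded compact_mesh lmeasurable_interior)

lemma measure_interior_mesh: "T \<in> \<T> \<Longrightarrow> measure lebesgue (interior T) = measure lebesgue T"
  by (intro measure_interior compact_imp_bounded compact_mesh negligible_convex_frontier convex_mesh)

lemma face_Int_mesh: "T \<in> \<T> \<Longrightarrow> T' \<in> \<T> \<Longrightarrow> T \<inter> T' face_of T"
  using conforming by (auto simp: conforming_partition_def triangulation_def)

text \<open>By conformity the intersection is a face of \<open>T\<close>, and a proper face misses
  the interior. If it is all of \<open>T\<close>, then \<open>T\<close> is itself a proper face of
  \<open>T'\<close>, which contradicts that its interior lies in the interior of
  \<open>T'\<close>.\<close>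

lemma mesh_disjoint_interior:
  assumes "T \<in> \<T>" "T' \<in> \<T>" "x \<in> interior T" "x \<in> T'"
  shows "T' = T"
proof (rule ccontr)
  assume ne: "T' \<noteq> T"
  show False
  proof (cases "T \<inter> T' = T")
    case True
    then have sub: "T \<subseteq> T'" by blast
    then have "T face_of T'" using face_Int_mesh[OF assms(2,1)] by (simp add: Int_absorb1)
    then have "T \<inter> interior T' = {}" using ne by (intro face_of_disjoint_interior) auto
    moreover have "interior T \<subseteq> interior T'" using sub by (rule interior_mono)
    ultimately show False using assms(3) interior_subset[of T] by auto
  next
    case False
    then show False
      using face_of_disjoint_interior[OF face_Int_mesh[OF assms(1,2)] False] assms(3,4) interior_subset[of T] by auto
  qed
qed

text \<open>There are no hanging nodes: the extreme points of a face are those of the simplex that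
  lie in the face. This is applied to the common face from both sides.\<close>

lemma extreme_point_mesh:
  assumes "\<nu> \<in> vertices \<T>" "T \<in> \<T>" "\<nu> \<in> T"
  shows "\<nu> extreme_point_of T"
proof -
  obtain T' where T': "T' \<in> \<T>" "\<nu> extreme_point_of T'"
    using assms(1) by (auto simp: vertices_def)
  then have "\<nu> \<in> T'" by (simp add: extreme_point_of_def)
  then have "\<nu> extreme_point_of (T' \<inter> T)"
    using T' assms by (simp add: extreme_point_of_face[OF face_Int_mesh])
  then show ?thesis
    using extreme_point_of_face[OF face_Int_mesh[OF assms(2) T'(1)]] by (simp add: Int_commute)
qed

lemma dom_diff_interiors_negligible: "negligible (\<Omega> - (\<Union>T\<in>\<T>. interior T))"
proof -
  have "negligible (\<Union>T\<in>\<T>. frontier T)"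
    using finite_mesh convex_mesh by (auto intro!: negligible_Union negligible_convex_frontier)
  moreover have "\<Omega> - (\<Union>T\<in>\<T>. interior T) \<subseteq> (\<Union>T\<in>\<T>. frontier T)"
  proof
    fix x assume x: "x \<in> \<Omega> - (\<Union>T\<in>\<T>. interior T)"
    then have "x \<in> \<Union>\<T>" using conforming closure_subset[of \<Omega>] by (auto simp: conforming_partition_def)
    then obtain T where T: "T \<in> \<T>" "x \<in> T" by blast
    then have "x \<in> frontier T" using x closure_subset[of T] by (auto simp: frontier_def)
    then show "x \<in> (\<Union>T\<in>\<T>. frontier T)" using T by blast
  qed
  ultimately show ?thesis by (rule negligible_subset)
qed

text \<open>Interiors are used because they are disjoint and because a frontier point may lie in
  several simplices, so that formulas on one simplex are only available inside it. What the
  interiors leave out of the domain lies in frontiers of convex sets and is null.\<close>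

lemma dom_integral_eq_sum:
  fixes f :: "'a \<Rightarrow> real"
  assumes f: "\<And>T. T \<in> \<T> \<Longrightarrow> set_integrable lebesgue (interior T) f"
  shows "(LINT x:\<Omega>|lebesgue. f x) = (\<Sum>T\<in>\<T>. LINT x:interior T|lebesgue. f x)"
proof -
  let ?U = "\<Union>T\<in>\<T>. interior T"
  have sub: "?U \<subseteq> \<Omega>" using interior_mesh_subset by blast
  have U: "set_integrable lebesgue ?U f"
    using finite_mesh by (intro set_integrable_UN f) auto
  have neg: "negligible {x \<in> ?U - \<Omega>. f x \<noteq> 0}" "negligible {x \<in> \<Omega> - ?U. f x \<noteq> 0}"
  proof -
    have "{x \<in> ?U - \<Omega>. f x \<noteq> 0} = {}" using sub by blast
    then show "negligible {x \<in> ?U - \<Omega>. f x \<noteq> 0}" by (simp only: negligible_empty)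
    show "negligible {x \<in> \<Omega> - ?U. f x \<noteq> 0}"
      by (rule negligible_subset[OF dom_diff_interiors_negligible]) auto
  qed
  have "(LINT x:\<Omega>|lebesgue. f x) = integral \<Omega> f"
    using absolutely_integrable_spike_set[OF U neg] by (rule set_lebesgue_integral_eq_integral)
  also have "\<dots> = integral ?U f"
    using neg by (intro integral_spike_set)
  also have "\<dots> = (LINT x:?U|lebesgue. f x)"
    using U by (rule set_lebesgue_integral_eq_integral(2)[symmetric])
  also have "\<dots> = (\<Sum>T\<in>\<T>. LINT x:interior T|lebesgue. f x)"
  proof (rule set_integral_finite_Union[OF finite_mesh _ f])
    show "disjoint_family_on interior \<T>"
      unfolding disjoint_family_on_def
    proof (intro ballI impI equals0I)
      fix S T x assume "S \<in> \<T>" "T \<in> \<T>" "S \<noteq> T" "x \<in> interior S \<inter> interior T"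
      then show False using mesh_disjoint_interior[of S T x] interior_subset[of T] by auto
    qed
  qed auto
  finally show ?thesis .
qed

section \<open>Patches of vertices\<close>

text \<open>Two simplices overlap in a subset of a frontier, a null set. The sum runs over the whole
  mesh so that it can be compared termwise with integrals split over the mesh.\<close>

lemma measure_patch: "measure lebesgue (patch \<T> \<nu>) = (\<Sum>T\<in>\<T>. if \<nu> \<in> T then measure lebesgue T else 0)"
proof -
  have "measure lebesgue (patch \<T> \<nu>) = (\<Sum>T\<in>{T\<in>\<T>. \<nu> \<in> T}. measure lebesgue T)"
    unfolding patch_def
  proof (rule measure_negligible_finite_Union)
    show "pairwise (\<lambda>S T. negligible (S \<inter> T)) {T \<in> \<T>. \<nu> \<in> T}"
    proof (rule pairwiseI)
      fix S T assume ST: "S \<in> {T \<in> \<T>. \<nu> \<in> T}" "T \<in> {T \<in> \<T>. \<nu> \<in> T}" "S \<noteq> T"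
      then have "S \<inter> T \<subseteq> frontier S"
        using mesh_disjoint_interior[of S T] closure_subset[of S] by (auto simp: frontier_def)
      then show "negligible (S \<inter> T)"
        using ST convex_mesh negligible_convex_frontier negligible_subset by blast
    qed
  qed (use finite_mesh compact_mesh lmeasurable_compact in auto)
  then show ?thesis using finite_mesh by (simp add: sum.inter_filter)
qed

lemma mem_patch_interior:
  assumes "T \<in> \<T>" "x \<in> interior T"
  shows "x \<in> patch \<T> \<nu> \<longleftrightarrow> \<nu> \<in> T"
  using assms mesh_disjoint_interior[of T _ x] interior_subset[of T] by (auto simp: patch_def)

lemma closed_patch: "closed (patch \<T> \<nu>)"
  unfolding patch_def using finite_mesh compact_mesh compact_imp_closed by (intro closed_Union) auto

lemma corner_simplex_compact: "T \<in> \<T> \<Longrightarrow> compact (corner_simplex T \<nu>)"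
  unfolding corner_simplex_def by (intro compact_continuous_image continuous_intros compact_mesh)

lemma corner_simplex_subset: "T \<in> \<T> \<Longrightarrow> \<nu> \<in> T \<Longrightarrow> corner_simplex T \<nu> \<subseteq> T"
proof
  fix y assume T: "T \<in> \<T>" "\<nu> \<in> T" and "y \<in> corner_simplex T \<nu>"
  then obtain x where x: "x \<in> T" "y = (1/2) *\<^sub>R \<nu> + (1/2) *\<^sub>R x" by (auto simp: corner_simplex_eq)
  then show "y \<in> T" using T x convexD[OF convex_mesh, of T \<nu> x "1/2" "1/2"] by simp
qed

lemma integral_interior_if_const:
  "T \<in> \<T> \<Longrightarrow> (LINT x:interior T|lebesgue. (if \<nu> \<in> T then c else 0)) = c * (if \<nu> \<in> T then measure lebesgue T else 0)"
  for c :: real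
  using interior_lmeasurable[of T] measure_interior_mesh[of T]
  by (simp add: set_lebesgue_integral_def)

lemma set_integrable_const_interior: "T \<in> \<T> \<Longrightarrow> set_integrable lebesgue (interior T) (\<lambda>x. c)" for c :: real
  using interior_lmeasurable by (intro set_integrable_bounded_borel[where B = "\<bar>c\<bar>"]) auto

end

locale refined_mesh = conforming_mesh \<Omega> \<T>
  for \<Omega> :: "'a::euclidean_space set" and \<T> :: "'a set set" +
  fixes \<S> :: "'a set set"
  assumes refinement: "uniform_red_refinement \<T> \<S>"
begin

lemma patch_refinement_subset: "patch \<S> \<nu> \<subseteq> patch \<T> \<nu>"
proof -
  have "\<exists>T\<in>\<T>. S \<subseteq> T" if "S \<in> \<S>" for S
    using refinement that by (auto simp: uniform_red_refinement_def red_subdivision_def)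
  then show ?thesis unfolding patch_def by blast
qed

text \<open>A fine simplex that contains \<open>x\<close> comes from a coarse one that contains
  \<open>x\<close>, and this must be \<open>T\<close>. As \<open>\<nu>\<close> is then a vertex of
  \<open>T\<close>, the corner simplex is the only piece of \<open>T\<close> that contains
  it.\<close>

lemma mem_patch_refinement_interior:
  assumes "\<nu> \<in> vertices \<T>" "T \<in> \<T>" "x \<in> interior T"
  shows "x \<in> patch \<S> \<nu> \<longleftrightarrow> \<nu> \<in> T \<and> x \<in> corner_simplex T \<nu>"
proof -
  obtain R where R: "\<And>T. T \<in> \<T> \<Longrightarrow> red_subdivision T (R T)" and S: "\<S> = (\<Union>T\<in>\<T>. R T)"
    using refinement by (auto simp: uniform_red_refinement_def)
  have U: "\<Union>(R T) = T" if "T \<in> \<T>" for T using R[OF that] by (simp add: red_subdivision_def)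
  have c: "{S \<in> R T. \<nu> \<in> S} = {corner_simplex T \<nu>}" if "\<nu> \<in> T"
    using R[OF assms(2)] extreme_point_mesh[OF assms(1,2) that] by (simp add: red_subdivision_def)
  show ?thesis
  proof
    assume "x \<in> patch \<S> \<nu>"
    then obtain T' K where K: "T' \<in> \<T>" "K \<in> R T'" "\<nu> \<in> K" "x \<in> K"
      by (auto simp: patch_def S)
    then have "x \<in> T'" "\<nu> \<in> T'" using U[OF K(1)] by auto
    then have "T' = T" "\<nu> \<in> T" using mesh_disjoint_interior[OF assms(2) K(1) assms(3)] by auto
    then have "K \<in> {S \<in> R T. \<nu> \<in> S}" using K by simp
    then show "\<nu> \<in> T \<and> x \<in> corner_simplex T \<nu>" using K(4) c \<open>\<nu> \<in> T\<close> by simp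
  next
    assume *: "\<nu> \<in> T \<and> x \<in> corner_simplex T \<nu>"
    then have "corner_simplex T \<nu> \<in> {S \<in> R T. \<nu> \<in> S}" using c by simp
    then show "x \<in> patch \<S> \<nu>" using assms(2) * unfolding patch_def S by blast
  qed
qed

lemma dual_fun_interior:
  assumes "\<nu> \<in> vertices \<T>" "T \<in> \<T>" "x \<in> interior T"
  shows "dual_fun \<T> \<S> \<nu> x =
    (if \<nu> \<in> T then 2 ^ (DIM('a) + 1) * indicator (corner_simplex T \<nu>) x - 1 else 0)"
  using mem_patch_interior[OF assms(2,3)] mem_patch_refinement_interior[OF assms]
  by (simp add: dual_fun_def indicator_def)

text \<open>Inside the patch only the values \<open>q - 1\<close> and \<open>-1\<close> with
  \<open>q = 2^(d+1) \<ge> 2\<close> occur. The lower bound serves both the norm estimate and the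
  support.\<close>

lemma dual_fun_sq_interior:
  assumes "\<nu> \<in> vertices \<T>" "T \<in> \<T>" "x \<in> interior T" "\<nu> \<in> T"
  shows "1 \<le> (dual_fun \<T> \<S> \<nu> x)\<^sup>2" "(dual_fun \<T> \<S> \<nu> x)\<^sup>2 \<le> (2 ^ (DIM('a) + 1))\<^sup>2"
proof -
  define q :: real where "q = 2 ^ (DIM('a) + 1)"
  have q: "2 \<le> q" using power_increasing[of 1 "DIM('a) + 1" "2::real"] by (simp add: q_def)
  consider "dual_fun \<T> \<S> \<nu> x = q - 1" | "dual_fun \<T> \<S> \<nu> x = -1"
    using assms by (auto simp: dual_fun_interior indicator_def q_def split: if_splits)
  then have "1 \<le> (dual_fun \<T> \<S> \<nu> x)\<^sup>2 \<and> (dual_fun \<T> \<S> \<nu> x)\<^sup>2 \<le> q\<^sup>2"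
    using q power_mono[of 1 "q - 1" 2] power_mono[of "q - 1" q 2] one_le_power[of q 2] by cases auto
  then show "1 \<le> (dual_fun \<T> \<S> \<nu> x)\<^sup>2" "(dual_fun \<T> \<S> \<nu> x)\<^sup>2 \<le> (2 ^ (DIM('a) + 1))\<^sup>2"
    by (simp_all only: q_def)
qed

text \<open>The function has no zero in the interior of a simplex of the patch, and each simplex is
  the closure of its interior; conversely the patch is closed and the function vanishes off
  it.\<close>

lemma supp_dual_fun:
  assumes "\<nu> \<in> vertices \<T>"
  shows "supp_on \<Omega> (dual_fun \<T> \<S> \<nu>) = patch \<T> \<nu>"
proof
  have "dual_fun \<T> \<S> \<nu> x = 0" if "x \<notin> patch \<T> \<nu>" for x
  proof -
    have "x \<notin> patch \<S> \<nu>" using patch_refinement_subset that by blast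
    then show ?thesis using that by (simp add: dual_fun_def)
  qed
  then have "{x \<in> \<Omega>. dual_fun \<T> \<S> \<nu> x \<noteq> 0} \<subseteq> patch \<T> \<nu>" by blast
  then show "supp_on \<Omega> (dual_fun \<T> \<S> \<nu>) \<subseteq> patch \<T> \<nu>"
    unfolding supp_on_def using closed_patch by (rule closure_minimal)
  show "patch \<T> \<nu> \<subseteq> supp_on \<Omega> (dual_fun \<T> \<S> \<nu>)"
  proof
    fix x assume "x \<in> patch \<T> \<nu>"
    then obtain T where T: "T \<in> \<T>" "\<nu> \<in> T" "x \<in> T" by (auto simp: patch_def)
    have "dual_fun \<T> \<S> \<nu> y \<noteq> 0" if "y \<in> interior T" for y
      using dual_fun_sq_interior(1)[OF assms T(1) that T(2)] by auto
    then have "interior T \<subseteq> {x \<in> \<Omega>. dual_fun \<T> \<S> \<nu> x \<noteq> 0}"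
      using interior_mesh_subset[OF T(1)] by blast
    then have "closure (interior T) \<subseteq> supp_on \<Omega> (dual_fun \<T> \<S> \<nu>)"
      unfolding supp_on_def by (rule closure_mono)
    then show "x \<in> supp_on \<Omega> (dual_fun \<T> \<S> \<nu>)"
      using closure_interior_mesh T by blast
  qed
qed

end

section \<open>Nodal basis and dual functions\<close>

locale nodal_mesh = refined_mesh \<Omega> \<T> \<S>
  for \<Omega> :: "'a::euclidean_space set" and \<T> \<S> :: "'a set set" +
  fixes \<gamma> :: "'a set" and \<phi> :: "'a \<Rightarrow> 'a \<Rightarrow> real"
  assumes facets: "union_of_facets \<T> \<gamma>"
    and nodal: "nodal_basis \<Omega> \<gamma> \<T> \<phi>"
begin

section \<open>Values and bounds of the nodal functions\<close>

lemma free_vertexD: "\<nu> \<in> free_vertices \<gamma> \<T> \<Longrightarrow> \<nu> \<in> vertices \<T>"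
  by (simp add: free_vertices_def)

lemma nodal_affine:
  assumes "\<nu> \<in> free_vertices \<gamma> \<T>" "T \<in> \<T>"
  obtains \<alpha> \<beta> where "\<And>x. x \<in> T \<Longrightarrow> \<phi> \<nu> x = \<alpha> \<bullet> x + \<beta>"
proof -
  have "\<phi> \<nu> \<in> fe_space \<Omega> \<gamma> \<T>" using assms(1) nodal by (simp add: nodal_basis_def)
  then have "\<exists>\<alpha> \<beta>. \<forall>x\<in>T. \<phi> \<nu> x = \<alpha> \<bullet> x + \<beta>" using assms(2) by (simp add: fe_space_def)
  then show ?thesis using that by blast
qed

text \<open>This turns the trace condition into a pointwise one: each point of
  \<open>\<gamma>\<close> lies on a facet contained in \<open>\<gamma>\<close>, and the nodal
  function is affine on the adjacent simplex.\<close>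

lemma nodal_vanishes_on_boundary:
  assumes \<nu>: "\<nu> \<in> free_vertices \<gamma> \<T>" and x: "x \<in> \<gamma>"
  shows "\<phi> \<nu> x = 0"
proof -
  obtain \<F> where \<F>: "\<forall>F\<in>\<F>. \<exists>T\<in>\<T>. F facet_of T" "\<gamma> = \<Union>\<F>"
    using facets by (auto simp: union_of_facets_def)
  then obtain F where "F \<in> \<F>" and F: "x \<in> F" "F \<subseteq> \<gamma>" using x by blast
  then obtain T where T: "T \<in> \<T>" "F facet_of T" using \<F> by blast
  obtain \<alpha> \<beta> where aff: "\<And>x. x \<in> T \<Longrightarrow> \<phi> \<nu> x = \<alpha> \<bullet> x + \<beta>"
    using nodal_affine[OF \<nu> T(1)] by blast
  have "\<phi> \<nu> \<in> H1_0 \<Omega> \<gamma>"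
    using nodal \<nu> by (simp add: nodal_basis_def fe_space_def)
  then show ?thesis
    by (rule H1_0_affine_vanishes_on_facet[OF _ open_dom bounded_dom convex_mesh[OF T(1)]
        compact_imp_closed[OF compact_mesh[OF T(1)]] interior_mesh[OF T(1)]
        interior_mesh_subset[OF T(1)] T(2) F(2) aff F(1)])
qed

text \<open>The defining property only concerns free vertices; at a vertex on
  \<open>\<gamma>\<close> the value 0 comes from the boundary condition, and such a vertex differs
  from \<open>\<nu>\<close>.\<close>

lemma nodal_value:
  assumes "\<nu> \<in> free_vertices \<gamma> \<T>" "v \<in> vertices \<T>"
  shows "\<phi> \<nu> v = (if v = \<nu> then 1 else 0)"
proof (cases "v \<in> \<gamma>")
  case True
  then show ?thesis
    using assms nodal_vanishes_on_boundary by (auto simp: free_vertices_def)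
next
  case False
  then have "v \<in> free_vertices \<gamma> \<T>" using assms by (simp add: free_vertices_def)
  then show ?thesis using assms(1) nodal by (simp add: nodal_basis_def)
qed

text \<open>A simplex is the convex hull of its vertices, where the nodal function takes only the
  values 0 and 1, and 1 only at \<open>\<nu>\<close>.\<close>

lemma nodal_bounds:
  assumes \<nu>: "\<nu> \<in> free_vertices \<gamma> \<T>" and T: "T \<in> \<T>" "x \<in> T"
  shows "0 \<le> \<phi> \<nu> x \<and> \<phi> \<nu> x \<le> (if \<nu> \<in> T then 1 else 0)"
proof -
  obtain \<alpha> \<beta> where aff: "\<And>x. x \<in> T \<Longrightarrow> \<phi> \<nu> x = \<alpha> \<bullet> x + \<beta>"
    using nodal_affine[OF \<nu> T(1)] by blast
  have "0 \<le> \<alpha> \<bullet> x + \<beta> \<and> \<alpha> \<bullet> x + \<beta> \<le> (if \<nu> \<in> T then 1 else 0)"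
  proof (rule affine_function_hull_bounds)
    show "x \<in> convex hull {v. v extreme_point_of T}"
      using Krein_Milman_Minkowski[OF compact_mesh convex_mesh, of T] T by simp
    fix v assume "v \<in> {v. v extreme_point_of T}"
    then have "v \<in> T" "v \<in> vertices \<T>" using T by (auto simp: extreme_point_of_def vertices_def)
    then show "0 \<le> \<alpha> \<bullet> v + \<beta> \<and> \<alpha> \<bullet> v + \<beta> \<le> (if \<nu> \<in> T then 1 else 0)"
      using nodal_value[OF \<nu>, of v] aff[of v] by auto
  qed
  then show ?thesis using aff T by simp
qed

section \<open>Biorthogonality\<close>

text \<open>The general exponents let one argument cover the product and both squares. Inside
  \<open>T\<close> the integrand agrees with a bounded Borel function.\<close>

lemma nodal_dual_power_integrable:
  assumes \<nu>: "\<nu> \<in> free_vertices \<gamma> \<T>" and \<nu>': "\<nu>' \<in> free_vertices \<gamma> \<T>" and T: "T \<in> \<T>"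
  shows "set_integrable lebesgue (interior T) (\<lambda>x. \<phi> \<nu> x ^ i * dual_fun \<T> \<S> \<nu>' x ^ j)"
proof -
  let ?q = "2 ^ (DIM('a) + 1) :: real"
  obtain \<alpha> \<beta> where aff: "\<And>x. x \<in> T \<Longrightarrow> \<phi> \<nu> x = \<alpha> \<bullet> x + \<beta>"
    using nodal_affine[OF \<nu> T(1)] by blast
  define f where "f x = (\<alpha> \<bullet> x + \<beta>) ^ i * (if \<nu>' \<in> T then ?q * indicator (corner_simplex T \<nu>') x - 1 else 0) ^ j" for x
  have [measurable]: "corner_simplex T \<nu>' \<in> sets borel" by (intro borel_compact corner_simplex_compact T)
  have fm: "f \<in> borel_measurable borel" unfolding f_def by measurable
  have eq: "\<phi> \<nu> x ^ i * dual_fun \<T> \<S> \<nu>' x ^ j = f x" if "x \<in> interior T" for x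
    unfolding f_def dual_fun_interior[OF free_vertexD[OF \<nu>'] T that]
    using that aff interior_subset[of T] by (simp add: subset_iff)
  have "\<bar>f x\<bar> \<le> 1 * ?q ^ j" if x: "x \<in> interior T" for x
  proof -
    have "x \<in> T" using x interior_subset by blast
    then have "\<bar>\<phi> \<nu> x\<bar> \<le> 1"
      using nodal_bounds[OF \<nu> T \<open>x \<in> T\<close>] by (cases "\<nu> \<in> T") auto
    then have 1: "\<bar>\<phi> \<nu> x ^ i\<bar> \<le> 1" by (simp add: power_abs power_le_one)
    have "\<bar>dual_fun \<T> \<S> \<nu>' x\<bar> \<le> ?q"
    proof (cases "\<nu>' \<in> T")
      case True
      then show ?thesis
        using dual_fun_sq_interior(2)[OF free_vertexD[OF \<nu>'] T x] abs_le_square_iff[of "dual_fun \<T> \<S> \<nu>' x" ?q] by simp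
    qed (use dual_fun_interior[OF free_vertexD[OF \<nu>'] T x] in simp)
    then have 2: "\<bar>dual_fun \<T> \<S> \<nu>' x ^ j\<bar> \<le> ?q ^ j" unfolding power_abs by (intro power_mono) auto
    show ?thesis unfolding eq[OF x, symmetric] abs_mult using 1 2 by (intro mult_mono) auto
  qed
  then have "set_integrable lebesgue (interior T) f"
    using fm interior_lmeasurable[OF T] by (intro set_integrable_bounded_borel) auto
  then show ?thesis using eq set_integrable_cong[OF refl refl, of "interior T"] by (metis (no_types, lifting))
qed

lemmas nodal_dual_integrable = nodal_dual_power_integrable[where i = 1 and j = 1, simplified]
  and nodal_sq_integrable = nodal_dual_power_integrable[where i = 2 and j = 0, simplified]
  and dual_sq_integrable = nodal_dual_power_integrable[where i = 0 and j = 2, simplified]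

text \<open>If \<open>\<nu>'\<close> is a vertex of \<open>T\<close>, the corner identity evaluates
  the integral to \<open>\<phi> \<nu> \<nu>'\<close> times the volume of \<open>T\<close>; otherwise
  the dual function is zero inside \<open>T\<close>.\<close>

lemma nodal_dual_integral_simplex:
  assumes \<nu>: "\<nu> \<in> free_vertices \<gamma> \<T>" and \<nu>': "\<nu>' \<in> free_vertices \<gamma> \<T>" and T: "T \<in> \<T>"
  shows "(LINT x:interior T|lebesgue. \<phi> \<nu> x * dual_fun \<T> \<S> \<nu>' x)
    = (if \<nu> = \<nu>' \<and> \<nu>' \<in> T then measure lebesgue T else 0)"
proof (cases "\<nu>' \<in> T")
  case False
  then have "(LINT x:interior T|lebesgue. \<phi> \<nu> x * dual_fun \<T> \<S> \<nu>' x) = (LINT x:interior T|lebesgue. 0)"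
    using dual_fun_interior[OF free_vertexD[OF \<nu>'] T]
    by (intro set_lebesgue_integral_cong) auto
  then show ?thesis using False by simp
next
  case True
  let ?q = "2 ^ (DIM('a) + 1) :: real" and ?K = "corner_simplex T \<nu>'"
  obtain \<alpha> \<beta> where aff: "\<And>x. x \<in> T \<Longrightarrow> \<phi> \<nu> x = \<alpha> \<bullet> x + \<beta>"
    using nodal_affine[OF \<nu> T(1)] by blast
  let ?p = "\<lambda>x. \<alpha> \<bullet> x + \<beta>"
  let ?f = "\<lambda>x. ?q * (indicator ?K x * ?p x) - ?p x"
  have p: "set_integrable lebesgue S ?p" if "compact S" for S
    using that by (intro set_integrable_continuous_bounded continuous_intros compact_imp_bounded
        fmeasurableD[OF lmeasurable_compact])
  have ind: "(\<lambda>x. indicator T x *\<^sub>R (indicator ?K x * ?p x)) = (\<lambda>x. indicator ?K x *\<^sub>R ?p x)"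
    using corner_simplex_subset[OF T True] by (auto simp: indicator_def fun_eq_iff)
  have kp: "set_integrable lebesgue T (\<lambda>x. indicator ?K x * ?p x)"
    using p[OF corner_simplex_compact[OF T, of \<nu>']] unfolding set_integrable_def ind .
  have f: "set_integrable lebesgue T ?f"
    by (intro set_integral_diff set_integrable_mult_right kp p compact_mesh T)
  have "(LINT x:interior T|lebesgue. \<phi> \<nu> x * dual_fun \<T> \<S> \<nu>' x) = (LINT x:interior T|lebesgue. ?f x)"
  proof (intro set_lebesgue_integral_cong allI impI)
    fix x assume x: "x \<in> interior T"
    then have p: "\<phi> \<nu> x = ?p x" using aff interior_subset by blast
    have d: "dual_fun \<T> \<S> \<nu>' x = ?q * indicator ?K x - 1"
      using True dual_fun_interior[OF free_vertexD[OF \<nu>'] T x] by simp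
    show "\<phi> \<nu> x * dual_fun \<T> \<S> \<nu>' x = ?f x"
      unfolding p d by (simp add: algebra_simps)
  qed simp
  \<comment> \<open>The corner identity concerns the closed simplex, which differs from its interior
    by a null part of the frontier.\<close>
  also have "\<dots> = (LINT x:T|lebesgue. ?f x)"
  proof -
    have neg: "negligible (T - interior T)"
      using negligible_convex_frontier[OF convex_mesh[OF T]]
      by (rule negligible_subset) (auto simp: frontier_def intro: closure_subset[THEN subsetD])
    have "set_integrable lebesgue (interior T) ?f"
      by (rule set_integrable_subset[OF f]) (auto simp: interior_subset)
    moreover have "integral (interior T) ?f = integral T ?f"
      by (rule integral_spike_set) (auto intro!: negligible_subset[OF neg] intro: interior_subset[THEN subsetD])
    ultimately show ?thesis using f by (simp only: set_lebesgue_integral_eq_integral(2))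
  qed
  also have "\<dots> = ?q * (LINT x:T|lebesgue. indicator ?K x * ?p x) - (LINT x:T|lebesgue. ?p x)"
    by (subst set_integral_diff(2)) (auto intro!: set_integrable_mult_right kp p compact_mesh T)
  also have "(LINT x:T|lebesgue. indicator ?K x * ?p x) = (LINT x:?K|lebesgue. ?p x)"
    unfolding set_lebesgue_integral_def ind ..
  also have "?q * (LINT x:?K|lebesgue. ?p x) - (LINT x:T|lebesgue. ?p x) = ?p \<nu>' * measure lebesgue T"
    by (rule corner_simplex_integral_affine[OF compact_mesh[OF T]])
  also have "?p \<nu>' = (if \<nu> = \<nu>' then 1 else 0)"
    using aff[OF True] nodal_value[OF \<nu> free_vertexD[OF \<nu>']] by auto
  finally show ?thesis using True by simp
qed

lemma nodal_dual_inner: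
  assumes \<nu>: "\<nu> \<in> free_vertices \<gamma> \<T>" and \<nu>': "\<nu>' \<in> free_vertices \<gamma> \<T>"
  shows "L2_inner \<Omega> (\<phi> \<nu>) (dual_fun \<T> \<S> \<nu>') = (if \<nu> = \<nu>' then 1 else 0) * measure lebesgue (patch \<T> \<nu>')"
  unfolding L2_inner_def measure_patch using nodal_dual_integrable[OF \<nu> \<nu>']
  by (subst dom_integral_eq_sum) (auto simp: nodal_dual_integral_simplex[OF \<nu> \<nu>'] intro!: sum.cong sum.neutral)

section \<open>Norm estimates\<close>

lemma nodal_norm_upper:
  assumes \<nu>: "\<nu> \<in> free_vertices \<gamma> \<T>"
  shows "L2_inner \<Omega> (\<phi> \<nu>) (\<phi> \<nu>) \<le> measure lebesgue (patch \<T> \<nu>)"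
proof -
  have "(LINT x:interior T|lebesgue. (\<phi> \<nu> x)\<^sup>2) \<le> (if \<nu> \<in> T then measure lebesgue T else 0)" if T: "T \<in> \<T>" for T
  proof -
    have "(\<phi> \<nu> x)\<^sup>2 \<le> (if \<nu> \<in> T then 1 else 0)" if "x \<in> interior T" for x
      using nodal_bounds[OF \<nu> T, of x] that interior_subset[of T] by (auto simp: power_le_one split: if_splits)
    then have "(LINT x:interior T|lebesgue. (\<phi> \<nu> x)\<^sup>2) \<le> (LINT x:interior T|lebesgue. (if \<nu> \<in> T then 1 else 0))"
      by (intro set_integral_mono nodal_sq_integrable[OF \<nu> \<nu> T] set_integrable_const_interior T)
    then show ?thesis using integral_interior_if_const[OF T, of \<nu> 1] by simp
  qed
  then show ?thesis
    unfolding L2_inner_def power2_eq_square[symmetric] measure_patch using nodal_sq_integrable[OF \<nu> \<nu>]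
    by (subst dom_integral_eq_sum) (auto intro: sum_mono)
qed

lemma dual_norm_bounds:
  assumes \<nu>: "\<nu> \<in> free_vertices \<gamma> \<T>"
  shows "measure lebesgue (patch \<T> \<nu>) \<le> L2_inner \<Omega> (dual_fun \<T> \<S> \<nu>) (dual_fun \<T> \<S> \<nu>)"
    and "L2_inner \<Omega> (dual_fun \<T> \<S> \<nu>) (dual_fun \<T> \<S> \<nu>) \<le> (2 ^ (DIM('a) + 1))\<^sup>2 * measure lebesgue (patch \<T> \<nu>)"
proof -
  let ?I = "\<lambda>T. LINT x:interior T|lebesgue. (dual_fun \<T> \<S> \<nu> x)\<^sup>2" and ?Q = "(2 ^ (DIM('a) + 1))\<^sup>2 :: real"
  let ?m = "\<lambda>T. if \<nu> \<in> T then measure lebesgue T else 0"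
  have sum: "L2_inner \<Omega> (dual_fun \<T> \<S> \<nu>) (dual_fun \<T> \<S> \<nu>) = (\<Sum>T\<in>\<T>. ?I T)"
    unfolding L2_inner_def power2_eq_square[symmetric]
    by (intro dom_integral_eq_sum dual_sq_integrable[OF \<nu> \<nu>])
  have sq: "(if \<nu> \<in> T then 1 else 0) \<le> (dual_fun \<T> \<S> \<nu> x)\<^sup>2" "(dual_fun \<T> \<S> \<nu> x)\<^sup>2 \<le> (if \<nu> \<in> T then ?Q else 0)"
    if "T \<in> \<T>" "x \<in> interior T" for T x
    using dual_fun_sq_interior[OF free_vertexD[OF \<nu>] that] dual_fun_interior[OF free_vertexD[OF \<nu>] that] by auto
  have "?m T \<le> ?I T" if T: "T \<in> \<T>" for T
    using set_integral_mono[OF set_integrable_const_interior[OF T] dual_sq_integrable[OF \<nu> \<nu> T] sq(1)[OF T]]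
      integral_interior_if_const[OF T, of \<nu> 1] by simp
  then show "measure lebesgue (patch \<T> \<nu>) \<le> L2_inner \<Omega> (dual_fun \<T> \<S> \<nu>) (dual_fun \<T> \<S> \<nu>)"
    unfolding sum measure_patch by (rule sum_mono)
  have "?I T \<le> ?Q * ?m T" if T: "T \<in> \<T>" for T
    using set_integral_mono[OF dual_sq_integrable[OF \<nu> \<nu> T] set_integrable_const_interior[OF T] sq(2)[OF T]]
      integral_interior_if_const[OF T, of \<nu> ?Q] by simp
  then show "L2_inner \<Omega> (dual_fun \<T> \<S> \<nu>) (dual_fun \<T> \<S> \<nu>) \<le> ?Q * measure lebesgue (patch \<T> \<nu>)"
    unfolding sum measure_patch sum_distrib_left by (rule sum_mono)
qed

text \<open>With \<open>m\<close> the patch volume, Young's inequality and biorthogonality give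
  \<open>2 Q m\<close> as a lower bound for \<open>Q^2\<close> times the squared norm of
  \<open>\<phi> \<nu>\<close> plus that of the dual function. The latter is at most
  \<open>Q m\<close> and is absorbed on the left.\<close>

lemma nodal_norm_lower:
  assumes \<nu>: "\<nu> \<in> free_vertices \<gamma> \<T>"
  shows "measure lebesgue (patch \<T> \<nu>) \<le> (2 ^ (DIM('a) + 1))\<^sup>2 * L2_inner \<Omega> (\<phi> \<nu>) (\<phi> \<nu>)"
proof -
  define Q :: real where "Q = (2 ^ (DIM('a) + 1))\<^sup>2"
  let ?d = "dual_fun \<T> \<S> \<nu>"
  have Q: "Q > 0" by (simp add: Q_def)
  \<comment> \<open>The weight \<open>Q\<close> is the constant of the upper bound for the dual
    norm; it makes the absorbed term exactly half of the left side.\<close>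
  have young: "Q * (2 * (a * b)) \<le> Q * (Q * a\<^sup>2) + b\<^sup>2" for a b :: real
    using zero_le_power2[of "Q * a - b"] by (simp add: power2_eq_square algebra_simps)
  have "Q * (2 * (LINT x:interior T|lebesgue. \<phi> \<nu> x * ?d x)) \<le>
      Q * (Q * (LINT x:interior T|lebesgue. (\<phi> \<nu> x)\<^sup>2)) + (LINT x:interior T|lebesgue. (?d x)\<^sup>2)" if T: "T \<in> \<T>" for T
  proof -
    have "(LINT x:interior T|lebesgue. Q * (2 * (\<phi> \<nu> x * ?d x)))
        \<le> (LINT x:interior T|lebesgue. Q * (Q * (\<phi> \<nu> x)\<^sup>2) + (?d x)\<^sup>2)"
      by (intro set_integral_mono set_integral_add set_integrable_mult_right young
          nodal_dual_integrable[OF \<nu> \<nu> T] nodal_sq_integrable[OF \<nu> \<nu> T] dual_sq_integrable[OF \<nu> \<nu> T])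
    then show ?thesis
      by (subst (asm) set_integral_add(2))
        (auto intro!: set_integrable_mult_right nodal_sq_integrable[OF \<nu> \<nu> T] dual_sq_integrable[OF \<nu> \<nu> T])
  qed
  then have "(\<Sum>T\<in>\<T>. Q * (2 * (LINT x:interior T|lebesgue. \<phi> \<nu> x * ?d x))) \<le>
      (\<Sum>T\<in>\<T>. Q * (Q * (LINT x:interior T|lebesgue. (\<phi> \<nu> x)\<^sup>2)) + (LINT x:interior T|lebesgue. (?d x)\<^sup>2))"
    by (rule sum_mono)
  then have "Q * (2 * L2_inner \<Omega> (\<phi> \<nu>) ?d) \<le> Q * (Q * L2_inner \<Omega> (\<phi> \<nu>) (\<phi> \<nu>)) + L2_inner \<Omega> ?d ?d"
    unfolding L2_inner_def power2_eq_square[of "\<phi> _ _"] power2_eq_square[of "dual_fun _ _ _ _"]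
    using nodal_dual_integrable[OF \<nu> \<nu>] nodal_sq_integrable[OF \<nu> \<nu>] dual_sq_integrable[OF \<nu> \<nu>]
    by (subst (1 2 3) dom_integral_eq_sum) (simp_all add: sum_distrib_left sum.distrib power2_eq_square)
  then have "Q * measure lebesgue (patch \<T> \<nu>) \<le> Q * (Q * L2_inner \<Omega> (\<phi> \<nu>) (\<phi> \<nu>))"
    using dual_norm_bounds(2)[OF \<nu>, folded Q_def] nodal_dual_inner[OF \<nu> \<nu>] by simp
  then show ?thesis unfolding Q_def[symmetric] using Q by (simp only: mult_le_cancel_left_pos)
qed

text \<open>The two-sided bounds on the squared norms are multiplied before the square root is
  taken; the factors \<open>q^2\<close> then become \<open>q = 2^(d+1)\<close> in both
  directions.\<close>

lemma nodal_dual_norm_bounds: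
  assumes \<nu>: "\<nu> \<in> free_vertices \<gamma> \<T>"
  defines "N \<equiv> L2_norm \<Omega> (\<phi> \<nu>) * L2_norm \<Omega> (dual_fun \<T> \<S> \<nu>)"
  shows "N \<le> 2 ^ (DIM('a) + 1) * measure lebesgue (patch \<T> \<nu>)"
    and "measure lebesgue (patch \<T> \<nu>) \<le> 2 ^ (DIM('a) + 1) * N"
proof -
  let ?q = "2 ^ (DIM('a) + 1) :: real" and ?m = "measure lebesgue (patch \<T> \<nu>)"
  let ?a = "L2_inner \<Omega> (\<phi> \<nu>) (\<phi> \<nu>)" and ?b = "L2_inner \<Omega> (dual_fun \<T> \<S> \<nu>) (dual_fun \<T> \<S> \<nu>)"
  note b = nodal_norm_upper[OF \<nu>] nodal_norm_lower[OF \<nu>] dual_norm_bounds[OF \<nu>]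
  have nonneg: "0 \<le> ?a" "0 \<le> ?b"
    by (auto simp: L2_inner_def set_lebesgue_integral_def intro!: integral_nonneg_AE)
  have "N = sqrt (?a * ?b)" by (simp add: N_def L2_norm_def real_sqrt_mult)
  moreover have "sqrt (?a * ?b) \<le> sqrt ((?q * ?m)\<^sup>2)"
  proof (rule real_sqrt_le_mono)
    have "?a * ?b \<le> ?m * (?q\<^sup>2 * ?m)" using b nonneg by (intro mult_mono) auto
    then show "?a * ?b \<le> (?q * ?m)\<^sup>2" by (simp add: power2_eq_square mult_ac)
  qed
  moreover have "sqrt (?m\<^sup>2) \<le> sqrt (?q\<^sup>2 * (?a * ?b))"
  proof (rule real_sqrt_le_mono)
    have "?m * ?m \<le> (?q\<^sup>2 * ?a) * ?b" using b nonneg by (intro mult_mono) auto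
    then show "?m\<^sup>2 \<le> ?q\<^sup>2 * (?a * ?b)" by (simp add: power2_eq_square mult_ac)
  qed
  ultimately show "N \<le> ?q * ?m" "?m \<le> ?q * N" by (simp_all add: real_sqrt_mult)
qed

end

section \<open>Uniform biorthogonality, supports and equivalence of norms\<close>

theorem lemma5p6:
  fixes \<Omega> \<gamma> :: "'a::euclidean_space set"
    and \<TT> :: "'a set set set"
    and \<phi> :: "'a set set \<Rightarrow> 'a \<Rightarrow> 'a \<Rightarrow> real"
  assumes "polytopal_domain \<Omega>" and "bounded \<Omega>"
    and "closed \<gamma>" and "\<gamma> \<subseteq> frontier \<Omega>"
    and "\<forall>\<T>\<in>\<TT>. conforming_partition \<Omega> \<T>"
    and "uniformly_shape_regular \<TT>"
    and "DIM('a) = 1 \<longrightarrow> neighbours_comparable \<TT>"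
    and "\<forall>\<T>\<in>\<TT>. union_of_facets \<T> \<gamma>"
    and "\<forall>\<T>\<in>\<TT>. nodal_basis \<Omega> \<gamma> \<T> (\<phi> \<T>)"
  shows "\<exists>c>0. \<exists>C>0. \<forall>\<T>\<in>\<TT>. \<forall>\<S>. uniform_red_refinement \<T> \<S> \<longrightarrow>
     (\<forall>\<nu>\<in>free_vertices \<gamma> \<T>. \<forall>\<nu>'\<in>free_vertices \<gamma> \<T>.
        c * ((if \<nu> = \<nu>' then 1 else 0) *
             L2_norm \<Omega> (\<phi> \<T> \<nu>) * L2_norm \<Omega> (dual_fun \<T> \<S> \<nu>'))
          \<le> \<bar>L2_inner \<Omega> (\<phi> \<T> \<nu>) (dual_fun \<T> \<S> \<nu>')\<bar> \<and>
        \<bar>L2_inner \<Omega> (\<phi> \<T> \<nu>) (dual_fun \<T> \<S> \<nu>')\<bar>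
          \<le> C * ((if \<nu> = \<nu>' then 1 else 0) *
             L2_norm \<Omega> (\<phi> \<T> \<nu>) * L2_norm \<Omega> (dual_fun \<T> \<S> \<nu>'))) \<and>
     (\<forall>\<nu>\<in>free_vertices \<gamma> \<T>. supp_on \<Omega> (dual_fun \<T> \<S> \<nu>) = patch \<T> \<nu>) \<and>
     (\<forall>\<nu>\<in>free_vertices \<gamma> \<T>. \<forall>\<nu>'\<in>free_vertices \<gamma> \<T>.
        L2_inner \<Omega> (dual_fun \<T> \<S> \<nu>) (\<phi> \<T> \<nu>') =
          (if \<nu> = \<nu>' then 1 else 0) * measure lebesgue (patch \<T> \<nu>))"
proof -
  \<comment> \<open>Both constants, \<open>1 / ?q\<close> and \<open>?q\<close>, depend on the
    dimension alone and are thus uniform over the family.\<close>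
  let ?q = "2 ^ (DIM('a) + 1) :: real"
  have q: "?q > 0" "1 / ?q > 0" by simp_all
  show ?thesis
  proof (rule exI[of _ "1 / ?q"], intro conjI[OF q(2)], rule exI[of _ ?q], intro conjI[OF q(1)] ballI allI impI)
    fix \<T> \<S> assume \<T>: "\<T> \<in> \<TT>" and \<S>: "uniform_red_refinement \<T> \<S>"
    interpret nodal_mesh \<Omega> \<T> \<S> \<gamma> "\<phi> \<T>"
      using assms \<T> \<S> by unfold_locales (auto simp: polytopal_domain_def)
    let ?N = "\<lambda>\<nu> \<nu>'. (if \<nu> = \<nu>' then 1 else 0) * L2_norm \<Omega> (\<phi> \<T> \<nu>) * L2_norm \<Omega> (dual_fun \<T> \<S> \<nu>')"
    let ?I = "\<lambda>\<nu> \<nu>'. L2_inner \<Omega> (\<phi> \<T> \<nu>) (dual_fun \<T> \<S> \<nu>')"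
    have bounds: "1 / ?q * ?N \<nu> \<nu>' \<le> \<bar>?I \<nu> \<nu>'\<bar> \<and> \<bar>?I \<nu> \<nu>'\<bar> \<le> ?q * ?N \<nu> \<nu>'"
      if \<nu>: "\<nu> \<in> free_vertices \<gamma> \<T>" "\<nu>' \<in> free_vertices \<gamma> \<T>" for \<nu> \<nu>'
    proof (cases "\<nu> = \<nu>'")
      case True
      have I: "\<bar>?I \<nu>' \<nu>'\<bar> = measure lebesgue (patch \<T> \<nu>')"
        using nodal_dual_inner[OF \<nu>(2,2)] by simp
      have N: "?N \<nu>' \<nu>' = L2_norm \<Omega> (\<phi> \<T> \<nu>') * L2_norm \<Omega> (dual_fun \<T> \<S> \<nu>')" by simp
      show ?thesis unfolding True I N
      proof
        show "1 / ?q * (L2_norm \<Omega> (\<phi> \<T> \<nu>') * L2_norm \<Omega> (dual_fun \<T> \<S> \<nu>')) \<le> measure lebesgue (patch \<T> \<nu>')"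
          using nodal_dual_norm_bounds(1)[OF \<nu>(2)] q(1) by (simp add: pos_divide_le_eq mult.commute)
      qed (rule nodal_dual_norm_bounds(2)[OF \<nu>(2)])
    \<comment> \<open>For distinct vertices all three quantities are 0.\<close>
    qed (simp add: nodal_dual_inner[OF \<nu>])
    \<comment> \<open>The vertices exchange roles, because here the dual function is the first
      argument of the symmetric inner product.\<close>
    have "L2_inner \<Omega> (dual_fun \<T> \<S> \<nu>) (\<phi> \<T> \<nu>') = (if \<nu> = \<nu>' then 1 else 0) * measure lebesgue (patch \<T> \<nu>)"
      if "\<nu> \<in> free_vertices \<gamma> \<T>" "\<nu>' \<in> free_vertices \<gamma> \<T>" for \<nu> \<nu>'
      using nodal_dual_inner[OF that(2,1)] by (simp add: L2_inner_def mult.commute)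
    then show "(\<forall>\<nu>\<in>free_vertices \<gamma> \<T>. \<forall>\<nu>'\<in>free_vertices \<gamma> \<T>.
        1 / ?q * ?N \<nu> \<nu>' \<le> \<bar>?I \<nu> \<nu>'\<bar> \<and> \<bar>?I \<nu> \<nu>'\<bar> \<le> ?q * ?N \<nu> \<nu>') \<and>
      (\<forall>\<nu>\<in>free_vertices \<gamma> \<T>. supp_on \<Omega> (dual_fun \<T> \<S> \<nu>) = patch \<T> \<nu>) \<and>
      (\<forall>\<nu>\<in>free_vertices \<gamma> \<T>. \<forall>\<nu>'\<in>free_vertices \<gamma> \<T>.
        L2_inner \<Omega> (dual_fun \<T> \<S> \<nu>) (\<phi> \<T> \<nu>') =
          (if \<nu> = \<nu>' then 1 else 0) * measure lebesgue (patch \<T> \<nu>))"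
      using bounds supp_dual_fun[OF free_vertexD] by blast
  qed
qed

end
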